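(* Let $d\in\{2,3\}$, let $N\ge 1$ be an integer, let $0<\rho\le 1$ and $M>0$. Assume: (1) For every $1\le m\le N$, $K_m:\mathbb{R}^d\to\mathbb{R}$ is nontrivial (not identically zero) with $K_m,\Delta K_m\in L^1(\mathbb{R}^d)$; $u_{0,m}:\mathbb{R}^d\to\mathbb{R}$ belongs to $H^2(\mathbb{R}^d)$, and for some $1\le m\le N$ the function $u_{0,m}$ does not vanish identically in $\mathbb{R}^d$; and $T_m:H^2(\mathbb{R}^d)\to H^2(\mathbb{R}^d)$ is a bounded linear operator with norm $0<\|T_m\|<\infty$. (2) For every $1\le m\le N$, $g_m:\mathbb{R}^N\to\mathbb{R}$ satisfies $g_m(0)=0$; and $g=(g_1,\dots,g_N)$ restricted to the ball $I$ belongs to $D_M$ and does not vanish identically in $I$. (3) $$c_a M\big(\|u_0\|_{H^2(\mathbb{R}^d,\mathbb{R}^N)}+1\big)^2 Q\le \frac{\rho}{2}.$$ For $v\in B_\rho$ let $t_g v:=u=(u_1,\dots,u_N)^T$, where for $1\le m\le N$ $$u_m(x)=[T_m(u_{0,m}+v_m)](x)\int_{\mathbb{R}^d}K_m(x-y)\,g_m(u_0(y)+v(y))\,dy .$$ Then $t_g$ maps $B_\rho$ into $B_\rho$ and is a strict contraction (with respect to the norm of $H^2(\mathbb{R}^d,\mathbb{R}^N)$). The unique fixed point $u_p$ of $t_g$ is the only solution in $B_\rho$ of the system $$u_{p,m}(x)=[T_m(u_{0,m}+u_{p,m})](x)\int_{\mathbb{R}^d}K_m(x-y)\,g_m(u_0(y)+u_p(y))\,dy,\qquad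 1\le m\le N.$$
   Context: Here $d\in\{2,3\}$ and $N\ge1$ is an integer. Spaces and norms. $H^2(\mathbb{R}^d)$ is the space of real-valued $\phi\in L^2(\mathbb{R}^d)$ with $\Delta\phi\in L^2(\mathbb{R}^d)$, with norm $\|\phi\|_{H^2(\mathbb{R}^d)}^2:=\|\phi\|_{L^2(\mathbb{R}^d)}^2+\|\Delta\phi\|_{L^2(\mathbb{R}^d)}^2$. For a vector function $u=(u_1,\dots,u_N)^T$, $\|u\|_{H^2(\mathbb{R}^d,\mathbb{R}^N)}^2:=\sum_{m=1}^N\|u_m\|_{L^2(\mathbb{R}^d)}^2+\sum_{m=1}^N\|\Delta u_m\|_{L^2(\mathbb{R}^d)}^2$. $\|T_m\|$ is the operator norm of $T_m$ on $H^2(\mathbb{R}^d)$. We write $u_0=(u_{0,1},\dots,u_{0,N})^T$. Constants. $c_e>0$ is a (fixed) constant such that $\|\phi\|_{L^\infty(\mathbb{R}^d)}\le c_e\|\phi\|_{H^2(\mathbb{R}^d)}$ for all $\phi\in H^2(\mathbb{R}^d)$ (Sobolev embedding). $c_a>0$ is a (fixed) constant such that for all $\phi_1,\phi_2\in H^2(\mathbb{R}^d)$ one has $\phi_1\phi_2\in H^2(\mathbb{R}^d)$ and $\|\phi_1\phi_2\|_{H^2(\mathbb{R}^d)}\le c_a\|\phi_1\|_{H^2(\mathbb{R}^d)}\|\phi_2\|_{H^2(\mathbb{R}^d)}$ (algebra property). Further notation. $\|K_m\|_{\tilde W^{2,1}(\mathbb{R}^d)}:=\sqrt{\|K_m\|_{L^1(\mathbb{R}^d)}^2+\|\Delta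 K_m\|_{L^1(\mathbb{R}^d)}^2}$ and $Q:=\sqrt{\sum_{m=1}^N\|T_m\|^2\|K_m\|_{\tilde W^{2,1}(\mathbb{R}^d)}^2}$. $B_\rho:=\{u\in H^2(\mathbb{R}^d,\mathbb{R}^N): \|u\|_{H^2(\mathbb{R}^d,\mathbb{R}^N)}\le\rho\}$, where $0<\rho\le1$. $I:=\{z\in\mathbb{R}^N: |z|_{\mathbb{R}^N}\le c_e(\|u_0\|_{H^2(\mathbb{R}^d,\mathbb{R}^N)}+1)\}$. $\|g\|_{C^1(I,\mathbb{R}^N)}:=\sum_{m=1}^N\|g_m\|_{C^1(I)}$ with $\|g_m\|_{C^1(I)}:=\|g_m\|_{C(I)}+\sum_{n=1}^N\left\|\frac{\partial g_m}{\partial z_n}\right\|_{C(I)}$ and $\|\phi\|_{C(I)}:=\max_{z\in I}|\phi(z)|$. For $M>0$, $D_M:=\{g=(g_1,\dots,g_N)\in C^1(I,\mathbb{R}^N): \|g\|_{C^1(I,\mathbb{R}^N)}\le M\}$. *)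

theory Defs
  imports "HOL-Analysis.Analysis" "HOL-Probability.Essential_Supremum"
begin

text \<open>
  Elements of the function spaces below are represented by functions, not by
  equivalence classes; equality in such a space is equality almost everywhere
  with respect to the (complete) Lebesgue measure.
\<close>

definition partial_within :: "(real^'n) set \<Rightarrow> 'n \<Rightarrow> (real^'n \<Rightarrow> real) \<Rightarrow> real^'n \<Rightarrow> real" where
  "partial_within S i f x = frechet_derivative f (at x within S) (axis i 1)"

abbreviation partial :: "'n \<Rightarrow> (real^'n \<Rightarrow> real) \<Rightarrow> real^'n \<Rightarrow> real" where
  "partial \<equiv> partial_within UNIV"

primrec Ck :: "nat \<Rightarrow> (real^'n \<Rightarrow> real) \<Rightarrow> bool" where
  "Ck 0 f \<longleftrightarrow> continuous_on UNIV f"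
| "Ck (Suc k) f \<longleftrightarrow> (\<forall>x. f differentiable (at x)) \<and> (\<forall>i. Ck k (partial i f))"

definition test_function :: "(real^'n \<Rightarrow> real) \<Rightarrow> bool" where
  "test_function \<phi> \<longleftrightarrow> (\<forall>k. Ck k \<phi>) \<and> compact (closure {x. \<phi> x \<noteq> 0})"

definition laplacian :: "(real^'n \<Rightarrow> real) \<Rightarrow> real^'n \<Rightarrow> real" where
  "laplacian \<phi> x = (\<Sum>i\<in>UNIV. partial i (partial i \<phi>) x)"

definition loc_integrable :: "(real^'n \<Rightarrow> real) \<Rightarrow> bool" where
  "loc_integrable f \<longleftrightarrow> (\<forall>S. compact S \<longrightarrow> f absolutely_integrable_on S)"

definition is_weak_laplacian :: "(real^'n \<Rightarrow> real) \<Rightarrow> (real^'n \<Rightarrow> real) \<Rightarrow> bool" where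
  "is_weak_laplacian f h \<longleftrightarrow> loc_integrable f \<and> loc_integrable h \<and>
     (\<forall>\<phi>. test_function \<phi> \<longrightarrow>
        (\<integral>x. f x * laplacian \<phi> x \<partial>lebesgue) = (\<integral>x. h x * \<phi> x \<partial>lebesgue))"

text \<open>The choice is immaterial: weak Laplacians are unique up to a null set.\<close>

definition weak_laplacian :: "(real^'n \<Rightarrow> real) \<Rightarrow> real^'n \<Rightarrow> real" where
  "weak_laplacian f = (SOME h. is_weak_laplacian f h)"

definition L1 :: "(real^'n \<Rightarrow> real) set" where
  "L1 = {f. integrable lebesgue f}"

definition L1_norm :: "(real^'n \<Rightarrow> real) \<Rightarrow> real" where
  "L1_norm f = (\<integral>x. \<bar>f x\<bar> \<partial>lebesgue)"

definition L2 :: "(real^'n \<Rightarrow> real) set" where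
  "L2 = {f. f \<in> borel_measurable lebesgue \<and> integrable lebesgue (\<lambda>x. (f x)\<^sup>2)}"

definition L2_norm :: "(real^'n \<Rightarrow> real) \<Rightarrow> real" where
  "L2_norm f = sqrt (\<integral>x. (f x)\<^sup>2 \<partial>lebesgue)"

definition Linf_norm :: "(real^'n \<Rightarrow> real) \<Rightarrow> ereal" where
  "Linf_norm f = esssup lebesgue (\<lambda>x. ereal \<bar>f x\<bar>)"

definition W21 :: "(real^'n \<Rightarrow> real) set" where
  "W21 = {f \<in> L1. \<exists>h\<in>L1. is_weak_laplacian f h}"

definition W21_norm :: "(real^'n \<Rightarrow> real) \<Rightarrow> real" where
  "W21_norm f = sqrt ((L1_norm f)\<^sup>2 + (L1_norm (weak_laplacian f))\<^sup>2)"

definition H2 :: "(real^'n \<Rightarrow> real) set" where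
  "H2 = {f \<in> L2. \<exists>h\<in>L2. is_weak_laplacian f h}"

definition H2_norm :: "(real^'n \<Rightarrow> real) \<Rightarrow> real" where
  "H2_norm f = sqrt ((L2_norm f)\<^sup>2 + (L2_norm (weak_laplacian f))\<^sup>2)"

definition H2v :: "(real^'d \<Rightarrow> real^'N) set" where
  "H2v = {u. \<forall>m. (\<lambda>x. u x $ m) \<in> H2}"

definition H2v_norm :: "(real^'d \<Rightarrow> real^'N) \<Rightarrow> real" where
  "H2v_norm u = sqrt ((\<Sum>m\<in>UNIV. (L2_norm (\<lambda>x. u x $ m))\<^sup>2)
                    + (\<Sum>m\<in>UNIV. (L2_norm (weak_laplacian (\<lambda>x. u x $ m)))\<^sup>2))"

definition H2v_ball :: "real \<Rightarrow> (real^'d \<Rightarrow> real^'N) set" where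
  "H2v_ball \<rho> = {u \<in> H2v. H2v_norm u \<le> \<rho>}"

text \<open>
  A bounded linear operator on \<open>H2\<close>, acting on representatives: the second
  condition says that it is well defined on classes modulo null sets, and
  linearity is an identity between classes.
\<close>

definition bounded_linear_H2 :: "((real^'n \<Rightarrow> real) \<Rightarrow> (real^'n \<Rightarrow> real)) \<Rightarrow> bool" where
  "bounded_linear_H2 T \<longleftrightarrow>
     (\<forall>f\<in>H2. T f \<in> H2) \<and>
     (\<forall>f\<in>H2. \<forall>h\<in>H2. (AE x in lebesgue. f x = h x) \<longrightarrow> (AE x in lebesgue. T f x = T h x)) \<and>
     (\<forall>f\<in>H2. \<forall>h\<in>H2. AE x in lebesgue. T (\<lambda>y. f y + h y) x = T f x + T h x) \<and>
     (\<forall>c. \<forall>f\<in>H2. AE x in lebesgue. T (\<lambda>y. c * f y) x = c * T f x) \<and>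
     (\<exists>C. \<forall>f\<in>H2. H2_norm (T f) \<le> C * H2_norm f)"

text \<open>As in \<^const>\<open>onorm\<close>, the null element contributes \<open>0 / 0 = 0\<close>.\<close>

definition onorm_H2 :: "((real^'n \<Rightarrow> real) \<Rightarrow> (real^'n \<Rightarrow> real)) \<Rightarrow> real" where
  "onorm_H2 T = (SUP f\<in>H2. H2_norm (T f) / H2_norm f)"

definition Q_const :: "('N::finite \<Rightarrow> (real^'d \<Rightarrow> real) \<Rightarrow> (real^'d \<Rightarrow> real)) \<Rightarrow> ('N \<Rightarrow> real^'d \<Rightarrow> real) \<Rightarrow> real" where
  "Q_const T K = sqrt (\<Sum>m\<in>UNIV. (onorm_H2 (T m))\<^sup>2 * (W21_norm (K m))\<^sup>2)"

definition I_ball :: "real \<Rightarrow> (real^'d \<Rightarrow> real^'N) \<Rightarrow> (real^'N) set" where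
  "I_ball c_e u0 = {z. norm z \<le> c_e * (H2v_norm u0 + 1)}"

text \<open>
  On the closed balls \<open>S\<close> used here, derivatives relative to \<open>S\<close> are unique, so
  up to the boundary this is the usual space of continuously differentiable
  functions. By compactness the supremum below is a maximum.
\<close>

definition C1_on :: "(real^'N) set \<Rightarrow> (real^'N \<Rightarrow> real) \<Rightarrow> bool" where
  "C1_on S f \<longleftrightarrow> (\<forall>z\<in>S. f differentiable (at z within S)) \<and>
                 (\<forall>n. continuous_on S (partial_within S n f))"

definition C_norm :: "(real^'N) set \<Rightarrow> (real^'N \<Rightarrow> real) \<Rightarrow> real" where
  "C_norm S f = (SUP z\<in>S. \<bar>f z\<bar>)"

definition C1_norm :: "(real^'N) set \<Rightarrow> (real^'N \<Rightarrow> real) \<Rightarrow> real" where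
  "C1_norm S f = C_norm S f + (\<Sum>n\<in>UNIV. C_norm S (partial_within S n f))"

definition D_set :: "(real^'N) set \<Rightarrow> real \<Rightarrow> (real^'N \<Rightarrow> real^'N) set" where
  "D_set S M = {g. (\<forall>m. C1_on S (\<lambda>z. g z $ m)) \<and> (\<Sum>m\<in>UNIV. C1_norm S (\<lambda>z. g z $ m)) \<le> M}"

definition t_map ::
  "('N::finite \<Rightarrow> (real^'d \<Rightarrow> real) \<Rightarrow> (real^'d \<Rightarrow> real)) \<Rightarrow> ('N \<Rightarrow> real^'d \<Rightarrow> real)
    \<Rightarrow> (real^'d \<Rightarrow> real^'N) \<Rightarrow> (real^'N \<Rightarrow> real^'N) \<Rightarrow> (real^'d \<Rightarrow> real^'N) \<Rightarrow> real^'d \<Rightarrow> real^'N" where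
  "t_map T K u0 g v = (\<lambda>x. \<chi> m.
     T m (\<lambda>y. u0 y $ m + v y $ m) x * (\<integral>y. K m (x - y) * g (u0 y + v y) $ m \<partial>lebesgue))"

end

theory Submission
  imports Defs
begin

text \<open>
  The map sends \<open>v\<close> to the products \<open>T\<^sub>m (u\<^sub>0\<^sub>,\<^sub>m + v\<^sub>m) \<cdot> (K\<^sub>m * g\<^sub>m(u\<^sub>0 + v))\<close>, and everything follows from
  one estimate for such a product. The convolution with \<open>K\<^sub>m\<close> smooths: its weak Laplacian is the
  convolution with \<open>\<Delta>K\<^sub>m\<close>, so Young's inequality bounds its \<open>H\<^sup>2\<close> norm by the norm of the kernel
  times the \<open>L\<^sup>2\<close> norm of \<open>g\<^sub>m(u\<^sub>0 + v)\<close> (\<open>conv_H2\<close>). The algebra property and the operator norm of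
  \<open>T\<^sub>m\<close> then bound the product (\<open>H2_operator_mult_conv\<close>).

  Let \<open>A = \<parallel>u\<^sub>0\<parallel> + 1\<close>. For \<open>v\<close> in the ball, \<open>u\<^sub>0 + v\<close> has norm at most \<open>A\<close>, so the Sobolev embedding
  places its values almost everywhere in the ball on which \<open>g\<close> is controlled (\<open>H2v_AE_norm_le\<close>).
  There every \<open>g\<^sub>m\<close> is Lipschitz with constant \<open>M\<close> (\<open>C1_Lipschitz\<close>) and vanishes at zero, hence
  \<open>g\<^sub>m(u\<^sub>0 + v)\<close> has \<open>L\<^sup>2\<close> norm at most \<open>M A\<close>. Summing the components in quadrature, the image of \<open>v\<close>
  has norm at most \<open>c\<^sub>a M A\<^sup>2 Q \<le> \<rho> / 2\<close>. For differences, the product rule gives two terms of the same size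
  (\<open>H2_operator_mult_conv_diff\<close>), so the map is Lipschitz with constant
  \<open>2 c\<^sub>a M A Q \<le> \<rho> / A\<close>, which is less than one because \<open>\<rho> \<le> 1\<close> and \<open>u\<^sub>0\<close> is not zero.

  The fixed point is the limit of the iterates of the zero function
  (\<open>H2v_ball_fixed_point\<close>). The norm involves a chosen weak Laplacian, and it is a seminorm
  only because the weak Laplacian is unique up to null sets. That is the fundamental lemma of the
  calculus of variations (\<open>AE_zero_if_weakly_zero\<close>), which rests on explicit smooth bump functions.
  Completeness is obtained from that of \<open>L\<^sup>2\<close> (\<open>L2_complete_geometric\<close>) and closedness of the weak
  Laplacian (\<open>is_weak_laplacian_L2_limit\<close>).
\<close>

section \<open>Functions with iterated partial derivatives\<close>

lemma partial_eq:
  assumes "(f has_derivative D) (at x)"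
  shows "partial i f x = D (axis i 1)"
  using frechet_derivative_at[OF assms] by (simp add: partial_within_def)

lemma has_derivative_frechet:
  "f differentiable (at x) \<Longrightarrow> (f has_derivative frechet_derivative f (at x)) (at x)"
  by (simp add: frechet_derivative_works)

lemma Ck_Suc_imp_Ck: "Ck (Suc k) f \<Longrightarrow> Ck k f"
proof (induction k arbitrary: f)
  case 0
  then show ?case
    by (auto intro!: continuous_at_imp_continuous_on differentiable_imp_continuous_within)
next
  case (Suc k)
  then show ?case by (metis Ck.simps(2))
qed

lemma Ck_const: "Ck k (\<lambda>x::real^'n. c)"
proof (induction k arbitrary: c)
  case (Suc k)
  have "partial i (\<lambda>x::real^'n. c) = (\<lambda>x. 0)" for i
    by (rule ext, subst partial_eq[OF has_derivative_const]) simp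
  then show ?case using Suc by simp
qed simp

lemma partial_add:
  assumes "f differentiable (at x)" "g differentiable (at x)"
  shows "partial i (\<lambda>x. f x + g x) x = partial i f x + partial i g x"
  by (subst partial_eq[OF has_derivative_add[OF assms[THEN has_derivative_frechet]]])
     (simp add: partial_within_def)

lemma partial_mult:
  assumes "f differentiable (at x)" "g differentiable (at x)"
  shows "partial i (\<lambda>x. f x * g x) x = f x * partial i g x + partial i f x * g x"
  by (subst partial_eq[OF has_derivative_mult[OF assms[THEN has_derivative_frechet]]])
     (simp add: partial_within_def)

lemma Ck_add: "Ck k f \<Longrightarrow> Ck k g \<Longrightarrow> Ck k (\<lambda>x. f x + g x)"
proof (induction k arbitrary: f g)
  case (Suc k)
  have "partial i (\<lambda>x. f x + g x) = (\<lambda>x. partial i f x + partial i g x)" for i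
    using Suc.prems by (intro ext partial_add) auto
  then show ?case using Suc by (auto intro!: derivative_intros)
qed (auto intro: continuous_intros)

lemma Ck_mult: "Ck k f \<Longrightarrow> Ck k g \<Longrightarrow> Ck k (\<lambda>x. f x * g x)"
proof (induction k arbitrary: f g)
  case (Suc k)
  have "partial i (\<lambda>x. f x * g x) = (\<lambda>x. f x * partial i g x + partial i f x * g x)" for i
    using Suc.prems by (intro ext partial_mult) auto
  moreover have "Ck k (\<lambda>x. f x * partial i g x + partial i f x * g x)" for i
    using Suc.prems Suc.prems[THEN Ck_Suc_imp_Ck] by (intro Ck_add Suc.IH) auto
  ultimately show ?case using Suc.prems by (auto intro!: derivative_intros)
qed (auto intro: continuous_intros)

lemma Ck_prod: "finite A \<Longrightarrow> (\<And>i. i \<in> A \<Longrightarrow> Ck k (f i)) \<Longrightarrow> Ck k (\<lambda>x. \<Prod>i\<in>A. f i x)"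
  by (induction A rule: finite_induct) (auto intro: Ck_mult Ck_const)

text \<open>Differentiability itself is translated, so the default value of the derivative at a point where
  there is none is translated too.\<close>
lemma partial_translate: "partial i (\<lambda>x. f (x + y)) x = partial i f (x + y)"
proof -
  have eq: "((\<lambda>x. f (x + y)) has_derivative D) (at x) \<longleftrightarrow> (f has_derivative D) (at (x + y))" for D
  proof
    assume "((\<lambda>x. f (x + y)) has_derivative D) (at x)"
    then have a: "((\<lambda>x. f (x + y)) has_derivative D) (at ((x + y) - y))" by simp
    have "((\<lambda>z. z - y) has_derivative (\<lambda>h. h)) (at (x + y))"
      by (auto intro!: derivative_eq_intros)
    from has_derivative_compose[OF this a] show "(f has_derivative D) (at (x + y))" by simp
  next
    assume a: "(f has_derivative D) (at (x + y))"
    have "((\<lambda>z. z + y) has_derivative (\<lambda>h. h)) (at x)"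
      by (auto intro!: derivative_eq_intros)
    from has_derivative_compose[OF this a] show "((\<lambda>x. f (x + y)) has_derivative D) (at x)" by simp
  qed
  then show ?thesis by (simp add: partial_within_def frechet_derivative_def)
qed

lemma Ck_translate: "Ck k f \<Longrightarrow> Ck k (\<lambda>x. f (x + y))"
proof (induction k arbitrary: f)
  case 0
  then have "continuous_on UNIV f" by simp
  then have "continuous_on UNIV (\<lambda>x. f (x + y))"
    by (rule continuous_on_compose2) (auto intro: continuous_intros)
  then show ?case by simp
next
  case (Suc k)
  have "(\<lambda>x. f (x + y)) differentiable (at x)" for x
  proof -
    have "f differentiable (at (x + y))" using Suc.prems by simp
    then show ?thesis
      by (intro differentiable_compose[of f "\<lambda>x. x + y"]) (auto intro!: derivative_intros)
  qed
  then show ?case using Suc by (simp add: partial_translate[abs_def])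
qed

lemma laplacian_translate: "laplacian (\<lambda>x. f (x + y)) x = laplacian f (x + y)"
  by (simp add: laplacian_def partial_translate[abs_def])

section \<open>Smooth bump functions\<close>

text \<open>The derivative is asserted to exist rather than computed, so that closure under sums and
  multiples only needs a witness. Lifting to coordinates turns this into the notion of
  smoothness by iterated partial derivatives.\<close>
primrec Ck_real :: "nat \<Rightarrow> (real \<Rightarrow> real) \<Rightarrow> bool" where
  "Ck_real 0 f \<longleftrightarrow> continuous_on UNIV f"
| "Ck_real (Suc k) f \<longleftrightarrow> (\<exists>f'. (\<forall>x. (f has_real_derivative f' x) (at x)) \<and> Ck_real k f')"

lemma Ck_coord_affine:
  assumes "Ck_real k f"
  shows "Ck k (\<lambda>x::real^'n. f (c * x $ i + d))"
  using assms
proof (induction k arbitrary: f)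
  case 0
  then have "continuous_on UNIV f" by simp
  then have "continuous_on UNIV (\<lambda>x::real^'n. f (c * x $ i + d))"
    by (rule continuous_on_compose2) (auto intro!: continuous_intros)
  then show ?case by simp
next
  case (Suc k)
  then obtain f' where f': "\<And>x. (f has_real_derivative f' x) (at x)" "Ck_real k f'" by auto
  have D: "((\<lambda>x::real^'n. f (c * x $ i + d)) has_derivative
          (\<lambda>h. f' (c * x $ i + d) * (c * h $ i))) (at x)" for x
  proof -
    have "((\<lambda>x::real^'n. c * x $ i + d) has_derivative (\<lambda>h. c * h $ i)) (at x)"
      by (auto intro!: derivative_eq_intros bounded_linear.has_derivative[OF bounded_linear_vec_nth])
    from has_derivative_compose[OF this f'(1)[unfolded has_field_derivative_def]]
    show ?thesis .
  qed
  have P: "partial j (\<lambda>x::real^'n. f (c * x $ i + d)) =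
      (\<lambda>x. (if j = i then c else 0) * f' (c * x $ i + d))" for j
    by (rule ext, subst partial_eq[OF D]) (auto simp: axis_def)
  have "Ck k (\<lambda>x::real^'n. (if j = i then c else 0) * f' (c * x $ i + d))" for j
    by (intro Ck_mult Ck_const Suc.IH f')
  then show ?case using D P by (auto simp: differentiable_def)
qed

lemma Ck_real_cmult: "Ck_real k f \<Longrightarrow> Ck_real k (\<lambda>x. c * f x)"
proof (induction k arbitrary: f)
  case (Suc k)
  then obtain f' where "\<And>x. (f has_real_derivative f' x) (at x)" "Ck_real k f'" by auto
  with Suc.IH show ?case by (auto intro!: exI[of _ "\<lambda>x. c * f' x"] derivative_eq_intros)
qed (auto intro: continuous_intros)

lemma Ck_real_diff: "Ck_real k f \<Longrightarrow> Ck_real k g \<Longrightarrow> Ck_real k (\<lambda>x. f x - g x)"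
proof (induction k arbitrary: f g)
  case (Suc k)
  then obtain f' g' where "\<And>x. (f has_real_derivative f' x) (at x)" "Ck_real k f'"
    "\<And>x. (g has_real_derivative g' x) (at x)" "Ck_real k g'" by auto
  with Suc.IH show ?case by (auto intro!: exI[of _ "\<lambda>x. f' x - g' x"] derivative_eq_intros)
qed (auto intro: continuous_intros)

text \<open>The functions \<open>exp (- 1 / t) / t ^ m\<close>, extended by zero. Carrying the exponent \<open>m\<close> makes the
  family closed under differentiation up to linear combinations, so a single induction
  shows that all its members are smooth.\<close>
definition flat :: "nat \<Rightarrow> real \<Rightarrow> real" where
  "flat m t = (if 0 < t then inverse t ^ m * exp (- inverse t) else 0)"

lemma flat_tendsto_0: "(flat m \<longlongrightarrow> 0) (at 0)"
proof (rule filterlim_split_at_real)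
  show "(flat m \<longlongrightarrow> 0) (at_left 0)"
    by (rule tendsto_eventually) (auto simp: flat_def eventually_at_filter)
  have "((\<lambda>s::real. s ^ m / exp s) \<longlongrightarrow> 0) at_top" by (rule tendsto_power_div_exp_0)
  from filterlim_compose[OF this filterlim_inverse_at_top_right]
  have "((\<lambda>t::real. inverse t ^ m / exp (inverse t)) \<longlongrightarrow> 0) (at_right 0)" .
  then show "(flat m \<longlongrightarrow> 0) (at_right 0)"
    by (rule Lim_transform_eventually)
       (auto simp: flat_def eventually_at_filter exp_minus divide_inverse)
qed

text \<open>Away from the origin this is calculus. At the origin the difference quotient of \<open>flat m\<close> is
  \<open>flat (m + 1)\<close>, which tends to zero.\<close>
lemma flat_deriv:
  "(flat m has_real_derivative flat (m + 2) t - real m * flat (m + 1) t) (at t)"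
proof -
  consider "t > 0" | "t < 0" | "t = 0" by linarith
  then show ?thesis
  proof cases
    case 1
    have "inverse t ^ (m - 1) * real m * inverse t = real m * inverse t ^ m"
      by (cases m) auto
    then have "real m * inverse t ^ (m - 1) * (- (inverse t * inverse t)) * exp (- inverse t)
          + inverse t ^ m * (exp (- inverse t) * (inverse t * inverse t))
        = flat (m + 2) t - real m * flat (m + 1) t"
      using 1 by (auto simp: flat_def algebra_simps)
    moreover have "((\<lambda>t. inverse t ^ m * exp (- inverse t)) has_real_derivative
          real m * inverse t ^ (m - 1) * (- (inverse t * inverse t)) * exp (- inverse t)
          + inverse t ^ m * (exp (- inverse t) * (inverse t * inverse t))) (at t)"
      using 1 by (auto intro!: derivative_eq_intros simp: mult_ac)
    ultimately have "((\<lambda>t. inverse t ^ m * exp (- inverse t)) has_real_derivative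
            flat (m + 2) t - real m * flat (m + 1) t) (at t)"
      by simp
    then show ?thesis
      by (rule has_field_derivative_transform_within_open[of _ _ _ "{0<..}"])
         (use 1 in \<open>auto simp: flat_def\<close>)
  next
    case 2
    have "((\<lambda>t. 0) has_real_derivative flat (m + 2) t - real m * flat (m + 1) t) (at t)"
      using 2 by (simp add: flat_def)
    then show ?thesis
      by (rule has_field_derivative_transform_within_open[of _ _ _ "{..<0}"])
         (use 2 in \<open>auto simp: flat_def\<close>)
  next
    case 3
    have "((\<lambda>t. (flat m t - flat m 0) / (t - 0)) \<longlongrightarrow> 0) (at 0)"
      using flat_tendsto_0[of "Suc m"]
      by (rule Lim_transform_eventually)
         (auto simp: flat_def eventually_at_filter divide_inverse)
    then show ?thesis using 3 by (simp add: has_field_derivative_iff flat_def)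
  qed
qed

lemma Ck_real_flat: "Ck_real k (flat m)"
proof (induction k arbitrary: m)
  case 0
  show ?case
    by (auto intro!: continuous_at_imp_continuous_on DERIV_isCont flat_deriv)
next
  case (Suc k)
  show ?case
    using flat_deriv[of m] by (auto intro!: exI Ck_real_diff Ck_real_cmult Suc.IH)
qed

text \<open>Since \<open>flat 0\<close> tends to one at infinity and vanishes on the negative half line, the scaling by \<open>n\<close>
  turns these products into smooth approximations of the indicator of the box.\<close>
definition box_bump :: "nat \<Rightarrow> real^'n \<Rightarrow> real^'n \<Rightarrow> real^'n \<Rightarrow> real" where
  "box_bump n a b x =
     (\<Prod>i\<in>UNIV. flat 0 (real n * (x $ i - a $ i)) * flat 0 (real n * (b $ i - x $ i)))"

lemma flat_0_bounds: "0 \<le> flat 0 t" "flat 0 t \<le> 1"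
  by (auto simp: flat_def)

lemma box_bump_bounds: "0 \<le> box_bump n a b x" "box_bump n a b x \<le> 1"
  unfolding box_bump_def
  by (auto intro!: prod_nonneg prod_le_1 mult_le_one flat_0_bounds mult_nonneg_nonneg)

lemma box_bump_outside:
  assumes "x \<notin> box a b"
  shows "box_bump n a b x = 0"
proof -
  obtain i where "x $ i \<le> a $ i \<or> b $ i \<le> x $ i"
    using assms by (auto simp: mem_box_cart not_less)
  then have "flat 0 (real n * (x $ i - a $ i)) * flat 0 (real n * (b $ i - x $ i)) = 0"
    by (auto simp: flat_def zero_less_mult_iff)
  then show ?thesis by (auto simp: box_bump_def)
qed

lemma box_bump_tendsto: "(\<lambda>n. box_bump n a b x) \<longlonglongrightarrow> indicator (box a b) x"
proof (cases "x \<in> box a b")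
  case True
  have *: "(\<lambda>n. flat 0 (real n * c)) \<longlonglongrightarrow> 1" if "0 < c" for c
  proof -
    have "(\<lambda>n. exp (- (inverse (real n) * inverse c))) \<longlonglongrightarrow> exp (- (0 * inverse c))"
      by (intro tendsto_intros LIMSEQ_inverse_real_of_nat lim_inverse_n)
    then have "(\<lambda>n. exp (- (inverse (real n) * inverse c))) \<longlonglongrightarrow> 1" by simp
    then show ?thesis
      by (rule Lim_transform_eventually)
         (use that in \<open>auto simp: flat_def eventually_sequentially intro!: exI[of _ 1]\<close>)
  qed
  have "(\<lambda>n. box_bump n a b x) \<longlonglongrightarrow> (\<Prod>i\<in>(UNIV::'a set). 1 * 1)"
    unfolding box_bump_def
    using True by (intro tendsto_intros *) (auto simp: mem_box_cart)
  with True show ?thesis by simp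
qed (simp add: box_bump_outside)

lemma test_function_box_bump: "test_function (box_bump n a b)"
proof -
  have eq: "box_bump n a b = (\<lambda>x. \<Prod>i\<in>UNIV. flat 0 (real n * x $ i + (- (real n * a $ i)))
          * flat 0 ((- real n) * x $ i + real n * b $ i))"
    by (rule ext) (simp add: box_bump_def algebra_simps)
  have "Ck k (box_bump n a b)" for k
    unfolding eq by (intro Ck_prod Ck_mult Ck_coord_affine Ck_real_flat) auto
  moreover have "closure {x. box_bump n a b x \<noteq> 0} \<subseteq> cbox a b"
    using box_bump_outside[of _ a b n] box_subset_cbox[of a b]
    by (intro closure_minimal) auto
  then have "compact (closure {x. box_bump n a b x \<noteq> 0})"
    using bounded_subset[OF bounded_cbox] by (simp add: compact_eq_bounded_closed)
  ultimately show ?thesis by (auto simp: test_function_def)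
qed

section \<open>Test functions and the fundamental lemma\<close>

lemma partial_eq_0_outside:
  assumes "closed S" "\<And>x. x \<notin> S \<Longrightarrow> f x = 0" "x \<notin> S"
  shows "partial i f x = 0"
proof -
  have "(f has_derivative (\<lambda>h. 0)) (at x)"
    by (rule has_derivative_transform_within_open[of "\<lambda>x. 0" _ x UNIV "- S"])
       (use assms in auto)
  then show ?thesis by (subst partial_eq) auto
qed

lemma test_function_support:
  fixes \<phi> :: "real^'n \<Rightarrow> real"
  assumes "test_function \<phi>"
  obtains S where "compact S" "\<And>x. x \<notin> S \<Longrightarrow> \<phi> x = 0" "\<And>x. x \<notin> S \<Longrightarrow> laplacian \<phi> x = 0"
    "continuous_on UNIV \<phi>" "continuous_on UNIV (laplacian \<phi>)"
proof
  let ?S = "closure {x. \<phi> x \<noteq> 0}"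
  show "compact ?S" using assms by (simp add: test_function_def)
  show z: "\<phi> x = 0" if "x \<notin> ?S" for x
    using that closure_subset[of "{x. \<phi> x \<noteq> 0}"] by auto
  show "laplacian \<phi> x = 0" if "x \<notin> ?S" for x
  proof -
    have "partial i \<phi> y = 0" if "y \<notin> ?S" for i y
      by (rule partial_eq_0_outside[OF closed_closure z that])
    then have "partial i (partial i \<phi>) x = 0" for i
      by (rule partial_eq_0_outside[OF closed_closure _ that])
    then show ?thesis by (simp add: laplacian_def)
  qed
  have "Ck k \<phi>" for k using assms by (simp add: test_function_def)
  from this[of 0] this[of "Suc (Suc 0)"]
  show "continuous_on UNIV \<phi>" "continuous_on UNIV (laplacian \<phi>)"
    by (auto simp: laplacian_def[abs_def] intro!: continuous_intros)
qed

lemma test_function_translate: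
  fixes \<phi> :: "real^'n \<Rightarrow> real"
  assumes "test_function \<phi>"
  shows "test_function (\<lambda>x. \<phi> (x + y))"
proof -
  have "{x. \<phi> (x + y) \<noteq> 0} = (+) (- y) ` {x. \<phi> x \<noteq> 0}"
    by (auto simp: image_iff algebra_simps intro!: exI[of _ "_ + y"])
  then have "closure {x. \<phi> (x + y) \<noteq> 0} = (+) (- y) ` closure {x. \<phi> x \<noteq> 0}"
    using closure_translation[of "- y" "{x. \<phi> x \<noteq> 0}"] by simp
  with assms show ?thesis
    using compact_translation[of "closure {x. \<phi> x \<noteq> 0}" "- y"]
    by (auto simp: test_function_def intro: Ck_translate)
qed

lemma continuous_lebesgue_measurable:
  fixes \<psi> :: "real^'n \<Rightarrow> real"
  shows "continuous_on UNIV \<psi> \<Longrightarrow> \<psi> \<in> borel_measurable lebesgue"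
  by (intro measurable_completion) (simp add: borel_measurable_continuous_onI)

lemma continuous_compact_support_bounded:
  fixes \<psi> :: "real^'n \<Rightarrow> real"
  assumes "continuous_on UNIV \<psi>" "compact S" "\<And>x. x \<notin> S \<Longrightarrow> \<psi> x = 0"
  obtains C where "0 \<le> C" "\<And>x. \<bar>\<psi> x\<bar> \<le> C * indicator S x"
proof -
  have "bounded (\<psi> ` S)"
    using assms by (intro compact_imp_bounded compact_continuous_image)
       (auto intro: continuous_on_subset)
  then obtain C where "C > 0" "\<And>x. x \<in> S \<Longrightarrow> \<bar>\<psi> x\<bar> \<le> C"
    by (auto simp: bounded_pos)
  with assms(3) show ?thesis by (intro that[of C]) (auto simp: indicator_def)
qed

text \<open>The pairing of a locally integrable function with a test function or its Laplacian is a
  genuine integral; linearity of the weak Laplacian rests on this.\<close>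
lemma loc_integrable_mult_integrable:
  fixes f :: "real^'n \<Rightarrow> real"
  assumes f: "loc_integrable f"
    and \<psi>: "continuous_on UNIV \<psi>" "compact S" "\<And>x. x \<notin> S \<Longrightarrow> \<psi> x = 0"
  shows "integrable lebesgue (\<lambda>x. f x * \<psi> x)"
proof -
  obtain C where C: "0 \<le> C" "\<And>x. \<bar>\<psi> x\<bar> \<le> C * indicator S x"
    using continuous_compact_support_bounded[OF \<psi>] by blast
  have i: "integrable lebesgue (\<lambda>x. indicator S x *\<^sub>R f x)"
    using f \<psi>(2) by (simp add: loc_integrable_def set_integrable_def)
  have [measurable]: "\<psi> \<in> borel_measurable lebesgue"
    using \<psi>(1) by (rule continuous_lebesgue_measurable)
  have "(\<lambda>x. f x * \<psi> x) = (\<lambda>x. (indicator S x *\<^sub>R f x) * \<psi> x)"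
    using \<psi>(3) by (force simp: indicator_def)
  moreover have "integrable lebesgue (\<lambda>x. (indicator S x *\<^sub>R f x) * \<psi> x)"
  proof (rule Bochner_Integration.integrable_bound)
    show "integrable lebesgue (\<lambda>x. C * (indicator S x *\<^sub>R f x))" using i by simp
    show "(\<lambda>x. (indicator S x *\<^sub>R f x) * \<psi> x) \<in> borel_measurable lebesgue"
      using borel_measurable_integrable[OF i] by measurable
    show "AE x in lebesgue. norm ((indicator S x *\<^sub>R f x) * \<psi> x) \<le> norm (C * (indicator S x *\<^sub>R f x))"
    proof (rule AE_I2)
      fix x
      show "norm ((indicator S x *\<^sub>R f x) * \<psi> x) \<le> norm (C * (indicator S x *\<^sub>R f x))"
        using C(1) C(2)[of x]
        by (auto simp: indicator_def abs_mult mult.commute intro!: mult_right_mono split: if_splits)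
    qed
  qed
  ultimately show ?thesis by (simp only:)
qed

text \<open>Boxes form a generator of the Borel sets that is stable under intersection, so the Dynkin
  argument extends the vanishing of the integral to all Borel sets.\<close>
lemma AE_zero_if_box_integrals_zero:
  fixes f :: "'a::euclidean_space \<Rightarrow> real"
  assumes f: "integrable lborel f"
    and box: "\<And>a b. (\<integral>x. indicator (box a b) x * f x \<partial>lborel) = 0"
  shows "AE x in lborel. f x = 0"
proof (rule sigma_finite_measure.density_zero[OF lborel.sigma_finite_measure_axioms f])
  have [measurable]: "f \<in> borel_measurable borel" using f by auto
  have all: "(\<integral>x. f x \<partial>lborel) = 0"
  proof -
    have "(\<lambda>n. \<integral>x. indicator (box (- (real n *\<^sub>R One)) (real n *\<^sub>R One)) x * f x \<partial>lborel)
        \<longlonglongrightarrow> (\<integral>x. f x \<partial>lborel)"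
    proof (rule integral_dominated_convergence[where w = "\<lambda>x. norm (f x)"])
      show "AE x in lborel. (\<lambda>n. indicator (box (- (real n *\<^sub>R One)) (real n *\<^sub>R One)) x * f x)
          \<longlonglongrightarrow> f x"
      proof (rule AE_I2)
        fix x :: 'a
        obtain N where N: "x \<in> box (- (real N *\<^sub>R One)) (real N *\<^sub>R One)"
          using UN_box_eq_UNIV by blast
        then have "x \<in> box (- (real n *\<^sub>R One)) (real n *\<^sub>R One)" if "N \<le> n" for n
        proof -
          have "real N \<le> real n" using that by simp
          moreover have "- real N < x \<bullet> i \<and> x \<bullet> i < real N" if "i \<in> Basis" for i
            using N that by (auto simp: mem_box)
          ultimately have "- real n < x \<bullet> i \<and> x \<bullet> i < real n" if "i \<in> Basis" for i
            using that by (meson less_le_trans le_less_trans neg_le_iff_le)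
          then show ?thesis by (auto simp: mem_box)
        qed
        then show "(\<lambda>n. indicator (box (- (real n *\<^sub>R One)) (real n *\<^sub>R One)) x * f x) \<longlonglongrightarrow> f x"
          by (intro tendsto_eventually)
             (auto simp: eventually_sequentially indicator_def intro!: exI[of _ N])
      qed
      show "AE x in lborel. norm (indicator (box (- (real n *\<^sub>R One)) (real n *\<^sub>R One)) x * f x)
          \<le> norm (f x)" for n
        by (rule AE_I2) (auto simp: indicator_def)
    qed (use f in auto)
    then show ?thesis by (simp add: box LIMSEQ_const_iff)
  qed
  fix A assume "A \<in> sets (lborel :: 'a measure)"
  then have 3: "A \<in> sigma_sets UNIV (range (\<lambda>(a, b). box a b))"
    by (simp add: borel_eq_box)
  have 1: "Int_stable (range (\<lambda>(a::'a, b). box a b))"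
    by (auto simp: Int_stable_def box_Int_box)
  have 2: "range (\<lambda>(a::'a, b). box a b) \<subseteq> Pow UNIV" by simp
  from 1 2 3 have "(\<integral>x. indicator A x * f x \<partial>lborel) = 0"
  proof (induction A rule: sigma_sets_induct_disjoint)
    case (basic A)
    then show ?case by (auto simp: box)
  next
    case (compl A)
    have [measurable]: "A \<in> sets borel" using compl(1) by (simp add: borel_eq_box)
    have "(\<integral>x. indicator (UNIV - A) x * f x \<partial>lborel)
        = (\<integral>x. f x - indicator A x * f x \<partial>lborel)"
      by (intro Bochner_Integration.integral_cong) (auto simp: indicator_def)
    also have "\<dots> = 0"
      using integrable_mult_indicator[of A lborel f] f compl(2)
      by (subst Bochner_Integration.integral_diff) (auto simp: all)
    finally show ?case .
  next
    case (union A)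
    have [measurable]: "A i \<in> sets borel" for i using union(2) by (auto simp: borel_eq_box)
    have "set_integrable lborel (\<Union>i. A i) f"
      unfolding set_integrable_def using f by (intro integrable_mult_indicator) auto
    from lebesgue_integral_countable_add[OF _ _ this] union(1,3)
    show ?case by (auto simp: set_lebesgue_integral_def disjoint_family_on_def)
  qed auto
  then show "set_lebesgue_integral lborel A f = 0"
    by (simp add: set_lebesgue_integral_def)
qed

text \<open>The fundamental lemma of the calculus of variations. The bumps converge to the indicator of
  their box and are dominated by it, so all box integrals of \<open>h\<close> vanish.\<close>
lemma AE_zero_if_weakly_zero:
  fixes h :: "real^'n \<Rightarrow> real"
  assumes h: "loc_integrable h"
    and 0: "\<And>\<phi>. test_function \<phi> \<Longrightarrow> (\<integral>x. h x * \<phi> x \<partial>lebesgue) = 0"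
  shows "AE x in lebesgue. h x = 0"
proof -
  have ind: "integrable lebesgue (\<lambda>x. indicator (cbox a b) x * h x)" for a b
    using h by (simp add: loc_integrable_def set_integrable_def)
  have eq: "(\<integral>x. indicator (box a b) x * h x \<partial>lebesgue) = 0" for a b
  proof -
    have bm: "box_bump n a b \<in> borel_measurable lebesgue" for n
      using test_function_support[OF test_function_box_bump]
      by (metis continuous_lebesgue_measurable)
    have hm: "(\<lambda>x. indicator (cbox a b) x * h x) \<in> borel_measurable lebesgue"
      using borel_measurable_integrable[OF ind] .
    have e1: "box_bump n a b x * h x = box_bump n a b x * (indicator (cbox a b) x * h x)" for n x
      using box_bump_outside[of x a b n] box_subset_cbox[of a b] by (auto simp: indicator_def)
    have e2: "indicator (box a b) x * h x = indicator (box a b) x * (indicator (cbox a b) x * h x)" for x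
      using box_subset_cbox[of a b] by (auto simp: indicator_def)
    have "(\<lambda>n. \<integral>x. box_bump n a b x * h x \<partial>lebesgue)
        \<longlonglongrightarrow> (\<integral>x. indicator (box a b) x * h x \<partial>lebesgue)"
    proof (rule integral_dominated_convergence[where w = "\<lambda>x. \<bar>indicator (cbox a b) x * h x\<bar>"])
      show "(\<lambda>x. indicator (box a b) x * h x) \<in> borel_measurable lebesgue"
        unfolding e2 by (intro borel_measurable_times hm borel_measurable_indicator) auto
      show "(\<lambda>x. box_bump n a b x * h x) \<in> borel_measurable lebesgue" for n
        unfolding e1 by (intro borel_measurable_times hm bm)
      show "integrable lebesgue (\<lambda>x. \<bar>indicator (cbox a b) x * h x\<bar>)" using ind by auto
      show "AE x in lebesgue. (\<lambda>n. box_bump n a b x * h x) \<longlonglongrightarrow> indicator (box a b) x * h x"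
        by (intro AE_I2 tendsto_intros box_bump_tendsto)
      have "norm (box_bump n a b x * (indicator (cbox a b) x * h x))
            \<le> 1 * \<bar>indicator (cbox a b) x * h x\<bar>" for n x
        unfolding norm_mult real_norm_def abs_mult
        by (intro mult_right_mono) (use box_bump_bounds[of n a b x] in auto)
      then show "AE x in lebesgue. norm (box_bump n a b x * h x)
            \<le> \<bar>indicator (cbox a b) x * h x\<bar>" for n
        unfolding e1[of n] by (intro AE_I2) simp
    qed
    moreover have "(\<integral>x. box_bump n a b x * h x \<partial>lebesgue) = 0" for n
      using 0[OF test_function_box_bump[of n a b]] by (simp add: mult.commute)
    ultimately show ?thesis by (simp add: LIMSEQ_const_iff)
  qed
  have "AE x in lborel. indicator (box (- (real n *\<^sub>R One)) (real n *\<^sub>R One)) x * h x = 0" for n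
  proof -
    let ?B = "box (- (real n *\<^sub>R One)) (real n *\<^sub>R One) :: (real^'n) set"
    have i: "integrable lebesgue (\<lambda>x. indicator ?B x * h x)"
    proof -
      have "(\<lambda>x. indicator ?B x * h x) = (\<lambda>x. indicator ?B x *\<^sub>R (indicator (closure ?B) x * h x))"
        using closure_subset[of ?B] by (force simp: indicator_def)
      moreover have "closure ?B = {} \<or> closure ?B = cbox (- (real n *\<^sub>R One)) (real n *\<^sub>R One)"
        using closure_box by (cases "?B = {}") auto
      then have "integrable lebesgue (\<lambda>x. indicator (closure ?B) x * h x)"
        using ind by auto
      then have "integrable lebesgue (\<lambda>x. indicator ?B x *\<^sub>R (indicator (closure ?B) x * h x))"
        by (intro integrable_mult_indicator) auto
      ultimately show ?thesis by (simp only:)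
    qed
    obtain k where [measurable]: "k \<in> borel_measurable lborel"
      and k: "AE x in lborel. indicator ?B x * h x = k x"
      using completion_ex_borel_measurable_real[OF borel_measurable_integrable[OF i]] by auto
    have [measurable]: "(\<lambda>x. indicator ?B x * h x) \<in> borel_measurable lebesgue"
      using borel_measurable_integrable[OF i] .
    have "integrable lebesgue k"
      by (rule integrable_cong_AE_imp[OF i])
         (use k[THEN AE_completion] in \<open>auto simp: measurable_completion\<close>)
    then have ki: "integrable lborel k" by (simp add: integrable_completion)
    have "AE x in lborel. k x = 0"
    proof (rule AE_zero_if_box_integrals_zero[OF ki])
      fix a b :: "real^'n"
      obtain a' b' where ab: "box a b \<inter> ?B = box a' b'"
        by (rule that, rule box_Int_box)
      have "(\<integral>x. indicator (box a b) x * k x \<partial>lborel) = (\<integral>x. indicator (box a b) x * k x \<partial>lebesgue)"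
        by (rule integral_completion[symmetric]) measurable
      also have "\<dots> = (\<integral>x. indicator (box a b) x * (indicator ?B x * h x) \<partial>lebesgue)"
      proof (rule integral_cong_AE)
        show "(\<lambda>x. indicator (box a b) x * k x) \<in> borel_measurable lebesgue"
          by (rule measurable_completion) measurable
        show "(\<lambda>x. indicator (box a b) x * (indicator ?B x * h x)) \<in> borel_measurable lebesgue"
          by (rule borel_measurable_times) (auto intro: borel_measurable_indicator \<open>(\<lambda>x. indicator ?B x * h x) \<in> borel_measurable lebesgue\<close>)
      qed (use k[THEN AE_completion] in auto)
      also have "\<dots> = (\<integral>x. indicator (box a' b') x * h x \<partial>lebesgue)"
        by (simp add: ab[symmetric] indicator_inter_arith mult.assoc)
      finally show "(\<integral>x. indicator (box a b) x * k x \<partial>lborel) = 0" by (simp add: eq)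
    qed
    with k show ?thesis by auto
  qed
  then have "AE x in lborel. \<forall>n. indicator (box (- (real n *\<^sub>R One)) (real n *\<^sub>R One)) x * h x = 0"
    unfolding AE_all_countable by blast
  then have "AE x in lborel. h x = 0"
  proof eventually_elim
    case (elim x)
    obtain n where "x \<in> box (- (real n *\<^sub>R One)) (real n *\<^sub>R One)"
      using UN_box_eq_UNIV by blast
    then show ?case using spec[OF elim, of n] by simp
  qed
  then show ?thesis by (rule AE_completion)
qed

section \<open>Square integrable functions\<close>

lemma abs_mult_le_sum_squares: "\<bar>a * b\<bar> \<le> a\<^sup>2 + b\<^sup>2" for a b :: real
proof -
  have "2 * (\<bar>a\<bar> * \<bar>b\<bar>) \<le> a\<^sup>2 + b\<^sup>2"
    using sum_squares_bound[of "\<bar>a\<bar>" "\<bar>b\<bar>"] by simp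
  moreover have "0 \<le> \<bar>a\<bar> * \<bar>b\<bar>" by simp
  ultimately show ?thesis unfolding abs_mult by linarith
qed

lemma L2_integrable_mult:
  assumes "f \<in> L2" "g \<in> L2"
  shows "integrable lebesgue (\<lambda>x. f x * g x)"
proof (rule Bochner_Integration.integrable_bound)
  show "integrable lebesgue (\<lambda>x. (f x)\<^sup>2 + (g x)\<^sup>2)"
    using assms by (simp add: L2_def)
  show "(\<lambda>x. f x * g x) \<in> borel_measurable lebesgue"
    using assms by (auto simp: L2_def)
  show "AE x in lebesgue. norm (f x * g x) \<le> norm ((f x)\<^sup>2 + (g x)\<^sup>2)"
    by (simp add: abs_mult_le_sum_squares)
qed

lemma L2_add: "f \<in> L2 \<Longrightarrow> g \<in> L2 \<Longrightarrow> (\<lambda>x. f x + g x) \<in> L2"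
  using L2_integrable_mult[of f g]
  by (auto simp: L2_def power2_sum mult.assoc)

lemma L2_cmult: "f \<in> L2 \<Longrightarrow> (\<lambda>x. c * f x) \<in> L2"
  by (auto simp: L2_def power_mult_distrib)

lemma L2_diff: "f \<in> L2 \<Longrightarrow> g \<in> L2 \<Longrightarrow> (\<lambda>x. f x - g x) \<in> L2"
  using L2_add[of f "\<lambda>x. -1 * g x"] L2_cmult[of g "-1"] by simp

lemma L2_norm_nonneg [simp]: "0 \<le> L2_norm f"
  by (simp add: L2_norm_def)

lemma L2_norm_sq: "(L2_norm f)\<^sup>2 = (\<integral>x. (f x)\<^sup>2 \<partial>lebesgue)"
  by (simp add: L2_norm_def)

lemma L2_norm_cmult: "L2_norm (\<lambda>x. c * f x) = \<bar>c\<bar> * L2_norm f"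
  by (simp add: L2_norm_def power_mult_distrib real_sqrt_mult)

lemma L2_cong_AE:
  assumes "f \<in> L2" "AE x in lebesgue. f x = g x"
  shows "g \<in> L2" "L2_norm g = L2_norm f"
proof -
  have [measurable]: "f \<in> borel_measurable lebesgue" using assms(1) by (simp add: L2_def)
  have [measurable]: "g \<in> borel_measurable lebesgue"
    using assms(2) by (rule borel_measurable_AE[rotated]) simp
  have ae: "AE x in lebesgue. (f x)\<^sup>2 = (g x)\<^sup>2" using assms(2) by auto
  have "integrable lebesgue (\<lambda>x. (g x)\<^sup>2)"
    by (rule integrable_cong_AE_imp[of _ "\<lambda>x. (f x)\<^sup>2"]) (use assms ae in \<open>auto simp: L2_def\<close>)
  then show "g \<in> L2" by (simp add: L2_def)
  have "(\<integral>x. (g x)\<^sup>2 \<partial>lebesgue) = (\<integral>x. (f x)\<^sup>2 \<partial>lebesgue)"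
    by (rule integral_cong_AE) (use ae in auto)
  then show "L2_norm g = L2_norm f" by (simp add: L2_norm_def)
qed

lemma L2_norm_eq_0:
  assumes "f \<in> L2" "L2_norm f = 0"
  shows "AE x in lebesgue. f x = 0"
  using assms integral_nonneg_eq_0_iff_AE[of lebesgue "\<lambda>x. (f x)\<^sup>2"]
  by (auto simp: L2_def L2_norm_def)

text \<open>The quadratic \<open>t \<mapsto> \<integral> (f + t g)\<^sup>2\<close> is nonnegative; evaluate it at its minimum.\<close>
lemma L2_Cauchy_Schwarz:
  assumes f: "f \<in> L2" and g: "g \<in> L2"
  shows "\<bar>\<integral>x. f x * g x \<partial>lebesgue\<bar> \<le> L2_norm f * L2_norm g"
proof -
  let ?c = "\<integral>x. f x * g x \<partial>lebesgue"
  have fg: "integrable lebesgue (\<lambda>x. f x * g x)" using assms by (rule L2_integrable_mult)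
  have *: "0 \<le> (L2_norm f)\<^sup>2 + 2 * t * ?c + t\<^sup>2 * (L2_norm g)\<^sup>2" for t
  proof -
    have "0 \<le> (\<integral>x. (f x + t * g x)\<^sup>2 \<partial>lebesgue)" by simp
    also have "\<dots> = (\<integral>x. (f x)\<^sup>2 + 2 * t * (f x * g x) + t\<^sup>2 * (g x)\<^sup>2 \<partial>lebesgue)"
      by (simp add: power2_eq_square algebra_simps)
    also have "\<dots> = (L2_norm f)\<^sup>2 + 2 * t * ?c + t\<^sup>2 * (L2_norm g)\<^sup>2"
      using f g fg by (simp add: L2_def L2_norm_sq)
    finally show ?thesis .
  qed
  have "?c\<^sup>2 \<le> (L2_norm f * L2_norm g)\<^sup>2"
  proof (cases "L2_norm g = 0")
    case True
    have "?c = 0"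
      by (rule integral_eq_zero_AE) (use L2_norm_eq_0[OF g True] in auto)
    then show ?thesis by simp
  next
    case False
    then have p: "(L2_norm g)\<^sup>2 > 0" by simp
    \<comment> \<open>the minimum is at \<open>t = - c / b\<^sup>2\<close>, with \<open>b\<close> the norm of \<open>g\<close>\<close>
    have "0 \<le> (L2_norm f)\<^sup>2 + 2 * (- ?c / (L2_norm g)\<^sup>2) * ?c + (- ?c / (L2_norm g)\<^sup>2)\<^sup>2 * (L2_norm g)\<^sup>2"
      by (rule *)
    also have "\<dots> = (L2_norm f)\<^sup>2 - ?c\<^sup>2 / (L2_norm g)\<^sup>2"
      using False by (simp add: field_simps power2_eq_square)
    finally show ?thesis using p by (simp add: field_simps power_mult_distrib)
  qed
  then show ?thesis
    by (metis L2_norm_nonneg abs_le_square_iff abs_of_nonneg mult_nonneg_nonneg)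
qed

lemma L2_norm_triangle:
  assumes f: "f \<in> L2" and g: "g \<in> L2"
  shows "L2_norm (\<lambda>x. f x + g x) \<le> L2_norm f + L2_norm g"
proof (rule power2_le_imp_le)
  have fg: "integrable lebesgue (\<lambda>x. f x * g x)" using assms by (rule L2_integrable_mult)
  have "(L2_norm (\<lambda>x. f x + g x))\<^sup>2 = (\<integral>x. (f x)\<^sup>2 + (g x)\<^sup>2 + 2 * (f x * g x) \<partial>lebesgue)"
    by (simp add: L2_norm_sq power2_sum mult.assoc)
  also have "\<dots> = (L2_norm f)\<^sup>2 + (L2_norm g)\<^sup>2 + 2 * (\<integral>x. f x * g x \<partial>lebesgue)"
    using f g fg by (simp add: L2_def L2_norm_sq)
  also have "\<dots> \<le> (L2_norm f + L2_norm g)\<^sup>2"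
    using L2_Cauchy_Schwarz[OF assms] by (simp add: power2_sum)
  finally show "(L2_norm (\<lambda>x. f x + g x))\<^sup>2 \<le> (L2_norm f + L2_norm g)\<^sup>2" .
qed simp

lemma L2_mono:
  assumes g: "g \<in> L2" and f: "f \<in> borel_measurable lebesgue"
    and le: "AE x in lebesgue. \<bar>f x\<bar> \<le> \<bar>g x\<bar>"
  shows "f \<in> L2" "L2_norm f \<le> L2_norm g"
proof -
  have le2: "AE x in lebesgue. (f x)\<^sup>2 \<le> (g x)\<^sup>2"
    using le by (auto simp: abs_le_square_iff)
  have "integrable lebesgue (\<lambda>x. (f x)\<^sup>2)"
    by (rule Bochner_Integration.integrable_bound[of _ "\<lambda>x. (g x)\<^sup>2"])
       (use f g le2 in \<open>auto simp: L2_def\<close>)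
  then show "f \<in> L2" using f by (simp add: L2_def)
  then show "L2_norm f \<le> L2_norm g"
    using g le2 by (auto simp: L2_norm_def L2_def intro!: integral_mono_AE)
qed

lemma indicator_compact_L2:
  fixes S :: "(real^'n) set"
  assumes S: "compact S"
  shows "(indicator S :: real^'n \<Rightarrow> real) \<in> L2"
proof -
  have "emeasure lborel S < \<infinity>" using S by (rule emeasure_compact_finite)
  moreover have Sb: "S \<in> sets borel" using S by (simp add: borel_compact)
  ultimately have "integrable lborel (indicator S :: real^'n \<Rightarrow> real)"
    by (simp add: integrable_indicator_iff)
  then have i: "integrable lebesgue (indicator S :: real^'n \<Rightarrow> real)"
    using Sb by (subst integrable_completion) auto
  then show ?thesis
    using borel_measurable_integrable[OF i]
    by (simp add: L2_def power2_eq_square indicator_inter_arith[symmetric])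
qed

lemma L2_loc_integrable: "f \<in> L2 \<Longrightarrow> loc_integrable f"
  by (auto simp: loc_integrable_def set_integrable_def
      intro!: L2_integrable_mult indicator_compact_L2)

lemma continuous_compact_support_L2:
  fixes \<psi> :: "real^'n \<Rightarrow> real"
  assumes \<psi>: "continuous_on UNIV \<psi>" "compact S" "\<And>x. x \<notin> S \<Longrightarrow> \<psi> x = 0"
  shows "\<psi> \<in> L2"
proof -
  obtain C where C: "0 \<le> C" "\<And>x. \<bar>\<psi> x\<bar> \<le> C * indicator S x"
    using continuous_compact_support_bounded[OF \<psi>] by blast
  show ?thesis
    by (rule L2_mono[OF L2_cmult[OF indicator_compact_L2[OF \<psi>(2)], of C]])
       (use C continuous_lebesgue_measurable[OF \<psi>(1)] in \<open>auto simp: abs_mult\<close>)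
qed

text \<open>Completeness, in the only form that a contraction iteration needs. With \<open>e k\<close> the increments and
  the weights \<open>q ^ k\<close>, the Cauchy-Schwarz inequality bounds the square of the tail from \<open>n\<close> by
  \<open>q ^ n / (1 - q)\<close> times \<open>S = (\<Sum>k. (e k)\<^sup>2 / q ^ k)\<close>. The function \<open>S\<close> is integrable because
  the integral of \<open>(e k)\<^sup>2\<close> decays like \<open>q ^ (2 * k)\<close>, so this one bound gives pointwise
  convergence, square integrability of the limit and convergence in norm.\<close>
lemma L2_complete_geometric:
  fixes f :: "nat \<Rightarrow> real^'n \<Rightarrow> real"
  assumes f: "\<And>n. f n \<in> L2"
    and q: "0 < q" "q < 1"
    and d: "\<And>n. L2_norm (\<lambda>x. f (Suc n) x - f n x) \<le> C * q ^ n"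
  obtains F where "F \<in> L2" "(\<lambda>n. L2_norm (\<lambda>x. F x - f n x)) \<longlonglongrightarrow> 0"
proof -
  define e where "e k x = f (Suc k) x - f k x" for k x
  define s where "s k x = (e k x)\<^sup>2 / q ^ k" for k x
  define S where "S x = (\<Sum>k. s k x)" for x
  define F where "F x = lim (\<lambda>n. f n x)" for x
  have eL: "e k \<in> L2" for k unfolding e_def[abs_def] by (intro L2_diff f)
  have em [measurable]: "e k \<in> borel_measurable lebesgue" for k using eL[of k] by (simp add: L2_def)
  have fm [measurable]: "f k \<in> borel_measurable lebesgue" for k using f[of k] by (simp add: L2_def)
  have s0: "0 \<le> s k x" for k x using q by (simp add: s_def)
  have si: "integrable lebesgue (s k)" for k
    using eL[of k] by (simp add: s_def[abs_def] L2_def)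
  have sI: "(\<integral>x. s k x \<partial>lebesgue) \<le> C\<^sup>2 * q ^ k" for k
  proof -
    have "(\<integral>x. s k x \<partial>lebesgue) = (L2_norm (e k))\<^sup>2 / q ^ k"
      by (simp add: s_def L2_norm_sq)
    also have "\<dots> \<le> (C * q ^ k)\<^sup>2 / q ^ k"
      using d[of k] q by (intro divide_right_mono power_mono) (auto simp: e_def[abs_def])
    also have "\<dots> = C\<^sup>2 * q ^ k" using q by (simp add: power2_eq_square)
    finally show ?thesis .
  qed
  have geo: "summable (\<lambda>k. C\<^sup>2 * q ^ k)" using q by (intro summable_mult summable_geometric) simp
  have sumI: "summable (\<lambda>k. \<integral>x. norm (s k x) \<partial>lebesgue)"
    by (rule summable_comparison_test'[OF geo, of 0]) (use sI s0 in \<open>simp add: abs_of_nonneg\<close>)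
  have "(\<integral>\<^sup>+x. (\<Sum>k. ennreal (s k x)) \<partial>lebesgue) = (\<Sum>k. \<integral>\<^sup>+x. ennreal (s k x) \<partial>lebesgue)"
    by (rule nn_integral_suminf) (use si in auto)
  also have "\<dots> = (\<Sum>k. ennreal (\<integral>x. s k x \<partial>lebesgue))"
    by (intro suminf_cong nn_integral_eq_integral si) (simp add: s0)
  also have "\<dots> = ennreal (\<Sum>k. \<integral>x. s k x \<partial>lebesgue)"
    using sumI s0 by (intro suminf_ennreal2) (auto simp: abs_of_nonneg)
  finally have fin: "(\<integral>\<^sup>+x. (\<Sum>k. ennreal (s k x)) \<partial>lebesgue) \<noteq> \<infinity>" by simp
  have sumS: "AE x in lebesgue. summable (\<lambda>k. s k x)"
  proof -
    have "AE x in lebesgue. (\<Sum>k. ennreal (s k x)) \<noteq> \<infinity>"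
      by (rule nn_integral_PInf_AE[OF _ fin])
         (use si in \<open>auto intro!: borel_measurable_suminf_order measurable_compose[OF _ measurable_ennreal]\<close>)
    then show ?thesis
      by eventually_elim (auto intro!: summable_suminf_not_top s0)
  qed
  have Si: "integrable lebesgue S"
    unfolding S_def[abs_def]
    by (rule integrable_suminf) (use si sumS sumI s0 in \<open>auto simp: abs_of_nonneg\<close>)
  have tail: "AE x in lebesgue. \<forall>n. (F x - f n x)\<^sup>2 \<le> q ^ n / (1 - q) * S x"
    using sumS
  proof eventually_elim
    case (elim x)
    have "\<bar>e k x\<bar> \<le> q ^ k + s k x" for k
    proof -
      have "2 * (\<bar>e k x\<bar> * q ^ k) \<le> \<bar>e k x\<bar>\<^sup>2 + (q ^ k)\<^sup>2"
        using sum_squares_bound[of "\<bar>e k x\<bar>" "q ^ k"] by simp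
      then have "\<bar>e k x\<bar> * q ^ k \<le> \<bar>e k x\<bar>\<^sup>2 + (q ^ k)\<^sup>2"
        using q by (smt (verit) abs_ge_zero mult_nonneg_nonneg zero_le_power)
      then show ?thesis using q by (simp add: s_def field_simps power2_eq_square)
    qed
    then have "summable (\<lambda>k. e k x)"
      using elim q
      by (intro summable_comparison_test'[of "\<lambda>k. q ^ k + s k x" 0 "\<lambda>k. e k x"] summable_add summable_geometric) auto
    then have "(\<lambda>n. \<Sum>k<n. e k x) \<longlonglongrightarrow> (\<Sum>k. e k x)" by (rule summable_LIMSEQ)
    then have "(\<lambda>n. f n x - f 0 x) \<longlonglongrightarrow> (\<Sum>k. e k x)"
      using sum_lessThan_telescope[of "\<lambda>n. f n x"] by (simp add: e_def)
    then have "(\<lambda>n. f n x - f 0 x + f 0 x) \<longlonglongrightarrow> (\<Sum>k. e k x) + f 0 x"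
      by (intro tendsto_add tendsto_const)
    then have "convergent (\<lambda>n. f n x)" by (auto simp: convergent_def)
    then have lim: "(\<lambda>n. f n x) \<longlonglongrightarrow> F x" by (simp add: F_def convergent_LIMSEQ_iff)
    show ?case
    proof
      fix n
      have "(f m x - f n x)\<^sup>2 \<le> q ^ n / (1 - q) * S x" if "n \<le> m" for m
      proof -
        have "f m x - f n x = (\<Sum>k=n..<m. e k x)"
          unfolding e_def using sum_Suc_diff'[OF that, of "\<lambda>n. f n x"] by simp
        also have "\<dots> = (\<Sum>k=n..<m. sqrt (q ^ k) * (e k x / sqrt (q ^ k)))"
          using q by (intro sum.cong) auto
        finally have "(f m x - f n x)\<^sup>2 \<le> (\<Sum>k=n..<m. (sqrt (q ^ k))\<^sup>2) * (\<Sum>k=n..<m. (e k x / sqrt (q ^ k))\<^sup>2)"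
          by (simp only: Cauchy_Schwarz_ineq_sum)
        also have "\<dots> = (\<Sum>k=n..<m. q ^ k) * (\<Sum>k=n..<m. s k x)"
          using q by (simp add: s_def power_divide)
        also have "\<dots> \<le> (q ^ n / (1 - q)) * S x"
        proof (rule mult_mono)
          have "(\<Sum>k=n..<m. q ^ k) = (q ^ n - q ^ m) / (1 - q)"
          proof -
            have "(\<Sum>k=n..<m. q ^ k) = (\<Sum>k=n..<m. - (q ^ Suc k / (1 - q)) - - (q ^ k / (1 - q)))"
            proof (intro sum.cong refl)
              fix k
              have "q ^ k = (q ^ k * (1 - q)) / (1 - q)" using q by simp
              also have "\<dots> = - (q ^ Suc k / (1 - q)) - - (q ^ k / (1 - q))"
                by (simp add: algebra_simps diff_divide_distrib)
              finally show "q ^ k = - (q ^ Suc k / (1 - q)) - - (q ^ k / (1 - q))" .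
            qed
            also have "\<dots> = (q ^ n - q ^ m) / (1 - q)"
              using sum_Suc_diff'[OF that, of "\<lambda>k. - (q ^ k / (1 - q))"]
              by (simp add: diff_divide_distrib)
            finally show ?thesis .
          qed
          also have "\<dots> \<le> q ^ n / (1 - q)" using q by (simp add: divide_right_mono)
          finally show "(\<Sum>k=n..<m. q ^ k) \<le> q ^ n / (1 - q)" .
          show "(\<Sum>k=n..<m. s k x) \<le> S x"
            unfolding S_def by (rule sum_le_suminf) (use elim s0 in auto)
        qed (use q s0 in \<open>auto intro!: sum_nonneg\<close>)
        finally show ?thesis .
      qed
      then show "(F x - f n x)\<^sup>2 \<le> q ^ n / (1 - q) * S x"
        by (intro LIMSEQ_le_const2[OF tendsto_power[OF tendsto_diff[OF lim tendsto_const]]]) auto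
    qed
  qed
  have Fm [measurable]: "F \<in> borel_measurable lebesgue"
    unfolding F_def[abs_def] by (intro borel_measurable_lim_metric) measurable
  have int: "integrable lebesgue (\<lambda>x. (F x - f n x)\<^sup>2)" for n
  proof (rule Bochner_Integration.integrable_bound)
    show "integrable lebesgue (\<lambda>x. q ^ n / (1 - q) * S x)" using Si by simp
    show "AE x in lebesgue. norm ((F x - f n x)\<^sup>2) \<le> norm (q ^ n / (1 - q) * S x)"
      using tail by eventually_elim (smt (verit) real_norm_def zero_le_power2)
  qed measurable
  have "(\<lambda>x. F x - f 0 x) \<in> L2" using int by (simp add: L2_def)
  from L2_add[OF this f[of 0]] have FL: "F \<in> L2" by simp
  have le: "L2_norm (\<lambda>x. F x - f n x) \<le> sqrt (q ^ n / (1 - q) * (\<integral>x. S x \<partial>lebesgue))" for n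
  proof -
    have "(\<integral>x. (F x - f n x)\<^sup>2 \<partial>lebesgue) \<le> (\<integral>x. q ^ n / (1 - q) * S x \<partial>lebesgue)"
      by (rule integral_mono_AE) (use int Si tail in auto)
    then show ?thesis by (simp add: L2_norm_def)
  qed
  have "(\<lambda>n. sqrt (q ^ n / (1 - q) * (\<integral>x. S x \<partial>lebesgue)))
      \<longlonglongrightarrow> sqrt (0 / (1 - q) * (\<integral>x. S x \<partial>lebesgue))"
    using q by (intro tendsto_intros LIMSEQ_power_zero) auto
  then have "(\<lambda>n. sqrt (q ^ n / (1 - q) * (\<integral>x. S x \<partial>lebesgue))) \<longlonglongrightarrow> 0" by simp
  then have "(\<lambda>n. L2_norm (\<lambda>x. F x - f n x)) \<longlonglongrightarrow> 0"
    by (rule tendsto_sandwich[OF _ _ tendsto_const, rotated 2]) (use le in auto)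
  with FL show ?thesis by (rule that)
qed

section \<open>Weak Laplacians and the spaces of order two\<close>

lemma lebesgue_cong_AE:
  fixes f g :: "real^'n \<Rightarrow> real"
  assumes f: "integrable lebesgue f" and ae: "AE x in lebesgue. f x = g x"
  shows "integrable lebesgue g" "integral\<^sup>L lebesgue g = integral\<^sup>L lebesgue f"
proof -
  have m: "g \<in> borel_measurable lebesgue"
    using borel_measurable_AE[OF borel_measurable_integrable[OF f] ae] .
  show "integrable lebesgue g" using f m ae by (rule integrable_cong_AE_imp)
  show "integral\<^sup>L lebesgue g = integral\<^sup>L lebesgue f"
    by (rule integral_cong_AE) (use f m ae in auto)
qed

lemma loc_integrable_lincomb:
  assumes "loc_integrable f" "loc_integrable g"
  shows "loc_integrable (\<lambda>x. a * f x + b * g x)"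
  unfolding loc_integrable_def
proof (intro allI impI)
  fix S :: "(real^'a) set" assume "compact S"
  then have "f absolutely_integrable_on S" "g absolutely_integrable_on S"
    using assms by (auto simp: loc_integrable_def)
  then show "(\<lambda>x. a * f x + b * g x) absolutely_integrable_on S" by simp
qed

lemma is_weak_laplacian_integrable:
  assumes "is_weak_laplacian f h" "test_function \<phi>"
  shows "integrable lebesgue (\<lambda>x. f x * laplacian \<phi> x)" "integrable lebesgue (\<lambda>x. h x * \<phi> x)"
proof -
  obtain S where S: "compact S" "\<And>x. x \<notin> S \<Longrightarrow> \<phi> x = 0" "\<And>x. x \<notin> S \<Longrightarrow> laplacian \<phi> x = 0"
    "continuous_on UNIV \<phi>" "continuous_on UNIV (laplacian \<phi>)"
    using test_function_support[OF assms(2)] by blast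
  show "integrable lebesgue (\<lambda>x. f x * laplacian \<phi> x)" "integrable lebesgue (\<lambda>x. h x * \<phi> x)"
    using assms(1) loc_integrable_mult_integrable[OF _ S(5,1,3)]
      loc_integrable_mult_integrable[OF _ S(4,1,2)]
    by (auto simp: is_weak_laplacian_def)
qed

lemma is_weak_laplacian_lincomb:
  assumes f: "is_weak_laplacian f h" and g: "is_weak_laplacian g k"
  shows "is_weak_laplacian (\<lambda>x. a * f x + b * g x) (\<lambda>x. a * h x + b * k x)"
  unfolding is_weak_laplacian_def
proof (intro conjI allI impI)
  fix \<phi> :: "real^'a \<Rightarrow> real" assume \<phi>: "test_function \<phi>"
  note i = is_weak_laplacian_integrable[OF f \<phi>] is_weak_laplacian_integrable[OF g \<phi>]
  have "(\<integral>x. (a * f x + b * g x) * laplacian \<phi> x \<partial>lebesgue)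
      = (\<integral>x. a * (f x * laplacian \<phi> x) + b * (g x * laplacian \<phi> x) \<partial>lebesgue)"
    by (simp add: algebra_simps)
  also have "\<dots> = a * (\<integral>x. h x * \<phi> x \<partial>lebesgue) + b * (\<integral>x. k x * \<phi> x \<partial>lebesgue)"
    using i f g \<phi> by (simp add: is_weak_laplacian_def)
  also have "\<dots> = (\<integral>x. a * (h x * \<phi> x) + b * (k x * \<phi> x) \<partial>lebesgue)"
    using i by simp
  finally show "(\<integral>x. (a * f x + b * g x) * laplacian \<phi> x \<partial>lebesgue)
      = (\<integral>x. (a * h x + b * k x) * \<phi> x \<partial>lebesgue)"
    by (simp add: algebra_simps)
qed (use f g in \<open>auto simp: is_weak_laplacian_def intro!: loc_integrable_lincomb\<close>)

lemma loc_integrable_cong_AE: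
  fixes f g :: "real^'n \<Rightarrow> real"
  assumes "loc_integrable f" "AE x in lebesgue. f x = g x"
  shows "loc_integrable g"
  unfolding loc_integrable_def set_integrable_def
proof (intro allI impI)
  fix S :: "(real^'n) set" assume "compact S"
  then have "integrable lebesgue (\<lambda>x. indicator S x *\<^sub>R f x)"
    using assms(1) by (simp add: loc_integrable_def set_integrable_def)
  then show "integrable lebesgue (\<lambda>x. indicator S x *\<^sub>R g x)"
    by (rule lebesgue_cong_AE) (use assms(2) in auto)
qed

lemma is_weak_laplacian_cong_AE:
  assumes f: "is_weak_laplacian f h" and ae: "AE x in lebesgue. f x = g x"
  shows "is_weak_laplacian g h"
  unfolding is_weak_laplacian_def
proof (intro conjI allI impI)
  show "loc_integrable g" "loc_integrable h"
    using f loc_integrable_cong_AE[OF _ ae] by (auto simp: is_weak_laplacian_def)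
  fix \<phi> :: "real^'a \<Rightarrow> real" assume \<phi>: "test_function \<phi>"
  have "AE x in lebesgue. f x * laplacian \<phi> x = g x * laplacian \<phi> x" using ae by auto
  from lebesgue_cong_AE(2)[OF is_weak_laplacian_integrable(1)[OF f \<phi>] this]
  show "(\<integral>x. g x * laplacian \<phi> x \<partial>lebesgue) = (\<integral>x. h x * \<phi> x \<partial>lebesgue)"
    using f \<phi> by (simp add: is_weak_laplacian_def)
qed

text \<open>The difference of two weak Laplacians of \<open>f\<close> is a weak Laplacian of zero, hence orthogonal to all
  test functions.\<close>
lemma is_weak_laplacian_unique:
  assumes f: "is_weak_laplacian f h" and k: "is_weak_laplacian f k"
  shows "AE x in lebesgue. h x = k x"
proof -
  have *: "is_weak_laplacian (\<lambda>x. 1 * f x + (-1) * f x) (\<lambda>x. 1 * h x + (-1) * k x)"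
    by (rule is_weak_laplacian_lincomb[OF f k])
  have "AE x in lebesgue. 1 * h x + (-1) * k x = 0"
    by (rule AE_zero_if_weakly_zero) (use * in \<open>auto simp: is_weak_laplacian_def\<close>)
  then show ?thesis by auto
qed

lemma weak_laplacian_unique:
  assumes "is_weak_laplacian f h"
  shows "is_weak_laplacian f (weak_laplacian f)" "AE x in lebesgue. h x = weak_laplacian f x"
proof -
  show *: "is_weak_laplacian f (weak_laplacian f)"
    unfolding weak_laplacian_def using someI[of "is_weak_laplacian f", OF assms] .
  show "AE x in lebesgue. h x = weak_laplacian f x"
    by (rule is_weak_laplacian_unique[OF assms *])
qed

lemma H2D:
  assumes "f \<in> H2"
  shows "f \<in> L2" "weak_laplacian f \<in> L2" "is_weak_laplacian f (weak_laplacian f)"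
proof -
  obtain h where h: "h \<in> L2" "is_weak_laplacian f h" using assms by (auto simp: H2_def)
  show "f \<in> L2" using assms by (simp add: H2_def)
  show "weak_laplacian f \<in> L2"
    by (rule L2_cong_AE(1)[OF h(1) weak_laplacian_unique(2)[OF h(2)]])
  show "is_weak_laplacian f (weak_laplacian f)"
    by (rule weak_laplacian_unique(1)[OF h(2)])
qed

text \<open>By uniqueness, any square integrable weak Laplacian may be used to compute the norm, instead of
  the one that the choice operator picked.\<close>
lemma H2I:
  assumes "f \<in> L2" "h \<in> L2" "is_weak_laplacian f h"
  shows "f \<in> H2" "H2_norm f = norm (L2_norm f, L2_norm h)"
  using assms L2_cong_AE(2)[OF assms(2) weak_laplacian_unique(2)[OF assms(3)]]
  by (auto simp: H2_def H2_norm_def norm_Pair)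

lemma H2_norm_eq: "H2_norm f = norm (L2_norm f, L2_norm (weak_laplacian f))"
  by (simp add: H2_norm_def norm_Pair)

lemma H2_norm_nonneg [simp]: "0 \<le> H2_norm f"
  by (simp add: H2_norm_eq)

lemma L2_norm_le_H2_norm: "L2_norm f \<le> H2_norm f"
  unfolding H2_norm_eq using norm_fst_le[of "L2_norm f" "L2_norm (weak_laplacian f)"] by simp

lemma norm_Pair_mono:
  fixes a b c d :: real
  assumes "0 \<le> a" "a \<le> c" "0 \<le> b" "b \<le> d"
  shows "norm (a, b) \<le> norm (c, d)"
  unfolding norm_Pair using assms by (simp add: add_mono power_mono)

lemma H2_lincomb:
  assumes f: "f \<in> H2" and g: "g \<in> H2"
  shows "(\<lambda>x. a * f x + b * g x) \<in> H2"
    "H2_norm (\<lambda>x. a * f x + b * g x) \<le> \<bar>a\<bar> * H2_norm f + \<bar>b\<bar> * H2_norm g"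
proof -
  let ?h = "\<lambda>x. a * weak_laplacian f x + b * weak_laplacian g x"
  have L: "(\<lambda>x. a * f x + b * g x) \<in> L2" "?h \<in> L2"
    using H2D[OF f] H2D[OF g] by (intro L2_add L2_cmult; simp)+
  note W = is_weak_laplacian_lincomb[OF H2D(3)[OF f] H2D(3)[OF g], of a b]
  show "(\<lambda>x. a * f x + b * g x) \<in> H2" using L W by (rule H2I)
  have t: "L2_norm (\<lambda>x. a * u x + b * v x) \<le> \<bar>a\<bar> * L2_norm u + \<bar>b\<bar> * L2_norm v"
    if "u \<in> L2" "v \<in> L2" for u v :: "real^'a \<Rightarrow> real"
    using L2_norm_triangle[OF L2_cmult[OF that(1)] L2_cmult[OF that(2)]]
    by (simp add: L2_norm_cmult)
  have "H2_norm (\<lambda>x. a * f x + b * g x) = norm (L2_norm (\<lambda>x. a * f x + b * g x), L2_norm ?h)"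
    using L W by (rule H2I)
  also have "\<dots> \<le> norm (\<bar>a\<bar> * L2_norm f + \<bar>b\<bar> * L2_norm g,
      \<bar>a\<bar> * L2_norm (weak_laplacian f) + \<bar>b\<bar> * L2_norm (weak_laplacian g))"
    using H2D[OF f] H2D[OF g] by (intro norm_Pair_mono t) auto
  also have "\<dots> = norm (\<bar>a\<bar> *\<^sub>R (L2_norm f, L2_norm (weak_laplacian f))
      + \<bar>b\<bar> *\<^sub>R (L2_norm g, L2_norm (weak_laplacian g)))"
    by simp
  also have "\<dots> \<le> norm (\<bar>a\<bar> *\<^sub>R (L2_norm f, L2_norm (weak_laplacian f)))
      + norm (\<bar>b\<bar> *\<^sub>R (L2_norm g, L2_norm (weak_laplacian g)))"
    by (rule norm_triangle_ineq)
  also have "\<dots> = \<bar>a\<bar> * H2_norm f + \<bar>b\<bar> * H2_norm g"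
    unfolding norm_scaleR H2_norm_eq by simp
  finally show "H2_norm (\<lambda>x. a * f x + b * g x) \<le> \<bar>a\<bar> * H2_norm f + \<bar>b\<bar> * H2_norm g" .
qed

lemma H2_add:
  assumes "f \<in> H2" "g \<in> H2"
  shows "(\<lambda>x. f x + g x) \<in> H2" "H2_norm (\<lambda>x. f x + g x) \<le> H2_norm f + H2_norm g"
  using H2_lincomb[OF assms, of 1 1] by simp_all

lemma H2_diff:
  assumes "f \<in> H2" "g \<in> H2"
  shows "(\<lambda>x. f x - g x) \<in> H2" "H2_norm (\<lambda>x. f x - g x) \<le> H2_norm f + H2_norm g"
  using H2_lincomb[OF assms, of 1 "-1"] by simp_all

lemma H2_cong_AE:
  assumes f: "f \<in> H2" and ae: "AE x in lebesgue. f x = g x"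
  shows "g \<in> H2" "H2_norm g = H2_norm f"
  using H2I[OF L2_cong_AE(1)[OF H2D(1)[OF f] ae] H2D(2)[OF f]
      is_weak_laplacian_cong_AE[OF H2D(3)[OF f] ae]] L2_cong_AE(2)[OF H2D(1)[OF f] ae]
  by (simp_all add: H2_norm_eq)

text \<open>The weak Laplacian is a closed operator: both sides of the defining identity are continuous in
  the \<open>L2\<close> norm, because test functions and their Laplacians are square integrable.\<close>
lemma is_weak_laplacian_L2_limit:
  fixes f h :: "nat \<Rightarrow> real^'n \<Rightarrow> real"
  assumes w: "\<And>n. is_weak_laplacian (f n) (h n)"
    and L: "\<And>n. f n \<in> L2" "\<And>n. h n \<in> L2" "F \<in> L2" "H \<in> L2"
    and lim: "(\<lambda>n. L2_norm (\<lambda>x. F x - f n x)) \<longlonglongrightarrow> 0"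
      "(\<lambda>n. L2_norm (\<lambda>x. H x - h n x)) \<longlonglongrightarrow> 0"
  shows "is_weak_laplacian F H"
  unfolding is_weak_laplacian_def
proof (intro conjI allI impI)
  show "loc_integrable F" "loc_integrable H" using L by (auto intro: L2_loc_integrable)
  fix \<phi> :: "real^'n \<Rightarrow> real" assume \<phi>: "test_function \<phi>"
  obtain S where S: "compact S" "\<And>x. x \<notin> S \<Longrightarrow> \<phi> x = 0" "\<And>x. x \<notin> S \<Longrightarrow> laplacian \<phi> x = 0"
    "continuous_on UNIV \<phi>" "continuous_on UNIV (laplacian \<phi>)"
    using test_function_support[OF \<phi>] by blast
  note \<phi>L = continuous_compact_support_L2[OF S(4,1,2)] continuous_compact_support_L2[OF S(5,1,3)]
  have conv: "(\<lambda>n. \<integral>x. u n x * \<psi> x \<partial>lebesgue) \<longlonglongrightarrow> (\<integral>x. U x * \<psi> x \<partial>lebesgue)"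
    if u: "\<And>n. u n \<in> L2" "U \<in> L2" "\<psi> \<in> L2" and lim: "(\<lambda>n. L2_norm (\<lambda>x. U x - u n x)) \<longlonglongrightarrow> 0"
    for u :: "nat \<Rightarrow> real^'n \<Rightarrow> real" and U \<psi>
  proof -
    have le: "\<bar>(\<integral>x. U x * \<psi> x \<partial>lebesgue) - (\<integral>x. u n x * \<psi> x \<partial>lebesgue)\<bar>
        \<le> L2_norm (\<lambda>x. U x - u n x) * L2_norm \<psi>" for n
    proof -
      have "(\<integral>x. U x * \<psi> x \<partial>lebesgue) - (\<integral>x. u n x * \<psi> x \<partial>lebesgue)
          = (\<integral>x. (U x - u n x) * \<psi> x \<partial>lebesgue)"
        using L2_integrable_mult[OF u(2,3)] L2_integrable_mult[OF u(1,3)]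
        by (simp add: left_diff_distrib)
      then show ?thesis using L2_Cauchy_Schwarz[OF L2_diff[OF u(2) u(1)] u(3), of n] by simp
    qed
    have "(\<lambda>n. L2_norm (\<lambda>x. U x - u n x) * L2_norm \<psi>) \<longlonglongrightarrow> 0"
      using tendsto_mult[OF lim tendsto_const[of "L2_norm \<psi>"]] by simp
    then have "(\<lambda>n. (\<integral>x. U x * \<psi> x \<partial>lebesgue) - (\<integral>x. u n x * \<psi> x \<partial>lebesgue)) \<longlonglongrightarrow> 0"
      by (rule Lim_null_comparison[rotated]) (use le in auto)
    then have "(\<lambda>n. (\<integral>x. U x * \<psi> x \<partial>lebesgue)
        - ((\<integral>x. U x * \<psi> x \<partial>lebesgue) - (\<integral>x. u n x * \<psi> x \<partial>lebesgue)))
        \<longlonglongrightarrow> (\<integral>x. U x * \<psi> x \<partial>lebesgue) - 0"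
      by (intro tendsto_diff tendsto_const)
    then show ?thesis by simp
  qed
  have "(\<lambda>n. \<integral>x. f n x * laplacian \<phi> x \<partial>lebesgue) \<longlonglongrightarrow> (\<integral>x. F x * laplacian \<phi> x \<partial>lebesgue)"
    using L \<phi>L lim by (intro conv)
  moreover have "(\<lambda>n. \<integral>x. h n x * \<phi> x \<partial>lebesgue) \<longlonglongrightarrow> (\<integral>x. H x * \<phi> x \<partial>lebesgue)"
    using L \<phi>L lim by (intro conv)
  moreover have "(\<integral>x. f n x * laplacian \<phi> x \<partial>lebesgue) = (\<integral>x. h n x * \<phi> x \<partial>lebesgue)" for n
    using w[of n] \<phi> by (simp add: is_weak_laplacian_def)
  ultimately show "(\<integral>x. F x * laplacian \<phi> x \<partial>lebesgue) = (\<integral>x. H x * \<phi> x \<partial>lebesgue)"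
    using LIMSEQ_unique by simp
qed

lemma H2_complete_geometric:
  fixes f :: "nat \<Rightarrow> real^'n \<Rightarrow> real"
  assumes f: "\<And>n. f n \<in> H2"
    and q: "0 < q" "q < 1"
    and d: "\<And>n. H2_norm (\<lambda>x. f (Suc n) x - f n x) \<le> C * q ^ n"
  obtains F where "F \<in> H2" "(\<lambda>n. H2_norm (\<lambda>x. F x - f n x)) \<longlonglongrightarrow> 0"
proof -
  let ?h = "\<lambda>n. weak_laplacian (f n)"
  note fD = H2D[OF f]
  have wd: "is_weak_laplacian (\<lambda>x. u x - v x) (\<lambda>x. h x - k x)"
    if "is_weak_laplacian u h" "is_weak_laplacian v k" for u v h k :: "real^'n \<Rightarrow> real"
    using is_weak_laplacian_lincomb[OF that, of 1 "-1"] by simp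
  have "L2_norm (\<lambda>x. f (Suc n) x - f n x) \<le> C * q ^ n" for n
    using L2_norm_le_H2_norm d by (rule order_trans)
  then obtain F where F: "F \<in> L2" "(\<lambda>n. L2_norm (\<lambda>x. F x - f n x)) \<longlonglongrightarrow> 0"
    using L2_complete_geometric[where f = f, OF fD(1) q] by blast
  have "L2_norm (\<lambda>x. ?h (Suc n) x - ?h n x) \<le> C * q ^ n" for n
  proof -
    have "L2_norm (\<lambda>x. ?h (Suc n) x - ?h n x)
        \<le> norm (L2_norm (\<lambda>x. f (Suc n) x - f n x), L2_norm (\<lambda>x. ?h (Suc n) x - ?h n x))"
      using norm_snd_le[of "L2_norm (\<lambda>x. ?h (Suc n) x - ?h n x)" "L2_norm (\<lambda>x. f (Suc n) x - f n x)"]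
      by simp
    also have "\<dots> = H2_norm (\<lambda>x. f (Suc n) x - f n x)"
      by (rule H2I(2)[symmetric]) (intro L2_diff fD wd)+
    finally show ?thesis using d[of n] by simp
  qed
  then obtain H where H: "H \<in> L2" "(\<lambda>n. L2_norm (\<lambda>x. H x - ?h n x)) \<longlonglongrightarrow> 0"
    using L2_complete_geometric[where f = ?h, OF fD(2) q] by blast
  have w: "is_weak_laplacian F H"
    by (rule is_weak_laplacian_L2_limit[OF fD(3) fD(1,2) F(1) H(1) F(2) H(2)])
  have "H2_norm (\<lambda>x. F x - f n x) = norm (L2_norm (\<lambda>x. F x - f n x), L2_norm (\<lambda>x. H x - ?h n x))" for n
    by (rule H2I(2)) (intro L2_diff fD wd F H w)+
  moreover have "(\<lambda>n. norm (L2_norm (\<lambda>x. F x - f n x), L2_norm (\<lambda>x. H x - ?h n x)))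
      \<longlonglongrightarrow> norm (0::real, 0::real)"
    by (intro tendsto_norm tendsto_Pair F H)
  ultimately have "(\<lambda>n. H2_norm (\<lambda>x. F x - f n x)) \<longlonglongrightarrow> 0" by simp
  with H2I(1)[OF F(1) H(1) w] show ?thesis by (rule that)
qed

lemma H2v_norm_eq: "H2v_norm u = L2_set (\<lambda>m. H2_norm (\<lambda>x. u x $ m)) UNIV"
  by (simp add: H2v_norm_def L2_set_def H2_norm_def sum.distrib)

lemma H2v_norm_nonneg [simp]: "0 \<le> H2v_norm u"
  by (simp add: H2v_norm_eq)

lemma H2_norm_component_le: "H2_norm (\<lambda>x. u x $ m) \<le> H2v_norm u"
  unfolding H2v_norm_eq by (rule member_le_L2_set) auto

lemma H2v_lincomb:
  assumes "u \<in> H2v" "w \<in> H2v"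
  shows "(\<lambda>x. a *\<^sub>R u x + b *\<^sub>R w x) \<in> H2v"
    "H2v_norm (\<lambda>x. a *\<^sub>R u x + b *\<^sub>R w x) \<le> \<bar>a\<bar> * H2v_norm u + \<bar>b\<bar> * H2v_norm w"
proof -
  have *: "(\<lambda>x. u x $ m) \<in> H2" "(\<lambda>x. w x $ m) \<in> H2" for m using assms by (auto simp: H2v_def)
  show "(\<lambda>x. a *\<^sub>R u x + b *\<^sub>R w x) \<in> H2v" using H2_lincomb(1)[OF *] by (simp add: H2v_def)
  have "H2v_norm (\<lambda>x. a *\<^sub>R u x + b *\<^sub>R w x)
      \<le> L2_set (\<lambda>m. \<bar>a\<bar> * H2_norm (\<lambda>x. u x $ m) + \<bar>b\<bar> * H2_norm (\<lambda>x. w x $ m)) UNIV"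
    unfolding H2v_norm_eq using H2_lincomb(2)[OF *] by (intro L2_set_mono) auto
  also have "\<dots> \<le> L2_set (\<lambda>m. \<bar>a\<bar> * H2_norm (\<lambda>x. u x $ m)) UNIV
      + L2_set (\<lambda>m. \<bar>b\<bar> * H2_norm (\<lambda>x. w x $ m)) UNIV"
    by (rule L2_set_triangle_ineq)
  also have "\<dots> = \<bar>a\<bar> * H2v_norm u + \<bar>b\<bar> * H2v_norm w"
    unfolding H2v_norm_eq by (simp add: L2_set_right_distrib)
  finally show "H2v_norm (\<lambda>x. a *\<^sub>R u x + b *\<^sub>R w x) \<le> \<bar>a\<bar> * H2v_norm u + \<bar>b\<bar> * H2v_norm w" .
qed

lemma H2v_add:
  assumes "u \<in> H2v" "w \<in> H2v"
  shows "(\<lambda>x. u x + w x) \<in> H2v" "H2v_norm (\<lambda>x. u x + w x) \<le> H2v_norm u + H2v_norm w"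
  using H2v_lincomb[OF assms, of 1 1] by simp_all

lemma H2v_diff:
  assumes "u \<in> H2v" "w \<in> H2v"
  shows "(\<lambda>x. u x - w x) \<in> H2v"
  using H2v_lincomb(1)[OF assms, of 1 "-1"] by simp

lemma H2v_norm_minus_commute:
  assumes "u \<in> H2v" "w \<in> H2v"
  shows "H2v_norm (\<lambda>x. u x - w x) = H2v_norm (\<lambda>x. w x - u x)"
proof -
  have "H2v_norm (\<lambda>x. f x - g x) \<le> H2v_norm (\<lambda>x. g x - f x)"
    if "f \<in> H2v" "g \<in> H2v" for f g :: "real^'a \<Rightarrow> real^'b"
    using H2v_lincomb(2)[OF H2v_diff[OF that(2,1)] H2v_diff[OF that(2,1)], of "-1" 0] by simp
  with assms show ?thesis by (intro antisym)
qed

lemma H2v_norm_eq_0: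
  assumes "u \<in> H2v" "H2v_norm u = 0"
  shows "AE x in lebesgue. u x = 0"
proof -
  have "AE x in lebesgue. u x $ m = 0" for m
  proof (rule L2_norm_eq_0)
    show "(\<lambda>x. u x $ m) \<in> L2" using assms H2D(1) by (auto simp: H2v_def)
    show "L2_norm (\<lambda>x. u x $ m) = 0"
      using H2_norm_component_le[of u m] L2_norm_le_H2_norm[of "\<lambda>x. u x $ m"]
        L2_norm_nonneg[of "\<lambda>x. u x $ m"] assms(2) by linarith
  qed
  then have "AE x in lebesgue. \<forall>m\<in>UNIV. u x $ m = 0" by (subst AE_finite_all) auto
  then show ?thesis by (auto simp: vec_eq_iff)
qed

lemma H2_zero: "(\<lambda>x::real^'n. 0) \<in> H2" "H2_norm (\<lambda>x::real^'n. 0) = 0"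
proof -
  have L: "(\<lambda>x::real^'n. 0) \<in> L2" by (simp add: L2_def)
  then have "is_weak_laplacian (\<lambda>x::real^'n. 0) (\<lambda>x. 0)"
    by (simp add: is_weak_laplacian_def L2_loc_integrable)
  from H2I[OF L L this] show "(\<lambda>x::real^'n. 0) \<in> H2" "H2_norm (\<lambda>x::real^'n. 0) = 0"
    by (auto simp: L2_norm_def norm_Pair)
qed

lemma H2v_norm_AE_0:
  assumes ae: "AE x in lebesgue. u x = 0"
  shows "H2v_norm u = 0"
proof -
  have "AE x in lebesgue. 0 = u x $ m" for m using ae by auto
  from H2_cong_AE(2)[OF H2_zero(1) this] show ?thesis
    by (simp add: H2v_norm_eq L2_set_def H2_zero)
qed

lemma H2v_zero: "(\<lambda>x. 0) \<in> H2v" "H2v_norm (\<lambda>x. 0) = 0"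
  by (auto simp: H2v_def H2_zero intro: H2v_norm_AE_0)

lemma H2v_complete_geometric:
  fixes u :: "nat \<Rightarrow> real^'d \<Rightarrow> real^'N"
  assumes u: "\<And>n. u n \<in> H2v"
    and q: "0 < q" "q < 1"
    and d: "\<And>n. H2v_norm (\<lambda>x. u (Suc n) x - u n x) \<le> C * q ^ n"
  obtains U where "U \<in> H2v" "(\<lambda>n. H2v_norm (\<lambda>x. U x - u n x)) \<longlonglongrightarrow> 0"
proof -
  have "\<exists>F. F \<in> H2 \<and> (\<lambda>n. H2_norm (\<lambda>x. F x - u n x $ m)) \<longlonglongrightarrow> 0" for m
  proof -
    have "H2_norm (\<lambda>x. u (Suc n) x $ m - u n x $ m) \<le> C * q ^ n" for n
      using H2_norm_component_le[of "\<lambda>x. u (Suc n) x - u n x" m] d[of n] by simp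
    then obtain F where "F \<in> H2" "(\<lambda>n. H2_norm (\<lambda>x. F x - u n x $ m)) \<longlonglongrightarrow> 0"
      by (rule H2_complete_geometric[where f = "\<lambda>n x. u n x $ m", OF _ q, rotated])
        (use u in \<open>auto simp: H2v_def\<close>)
    then show ?thesis by blast
  qed
  then have "\<exists>F. \<forall>m. F m \<in> H2 \<and> (\<lambda>n. H2_norm (\<lambda>x. F m x - u n x $ m)) \<longlonglongrightarrow> 0"
    by (intro choice allI)
  then obtain F where F: "\<And>m. F m \<in> H2" "\<And>m. (\<lambda>n. H2_norm (\<lambda>x. F m x - u n x $ m)) \<longlonglongrightarrow> 0"
    by blast
  have "(\<lambda>n. H2v_norm (\<lambda>x. (\<chi> m. F m x) - u n x)) \<longlonglongrightarrow> sqrt (\<Sum>m\<in>(UNIV::'N set). 0\<^sup>2)"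
    unfolding H2v_norm_eq L2_set_def by (intro tendsto_intros) (simp add: F)
  then have "(\<lambda>n. H2v_norm (\<lambda>x. (\<chi> m. F m x) - u n x)) \<longlonglongrightarrow> 0" by simp
  moreover have "(\<lambda>x. \<chi> m. F m x) \<in> H2v" using F by (simp add: H2v_def)
  ultimately show ?thesis by (rule that[rotated])
qed

lemma H2v_L2_norm:
  assumes u: "u \<in> H2v"
  shows "(\<lambda>x. norm (u x)) \<in> L2" "L2_norm (\<lambda>x. norm (u x)) \<le> H2v_norm u"
proof -
  have L: "(\<lambda>x. u x $ m) \<in> L2" for m using u H2D(1) by (auto simp: H2v_def)
  have sq: "(norm (u x))\<^sup>2 = (\<Sum>m\<in>UNIV. (u x $ m)\<^sup>2)" for x
    by (simp add: norm_vec_def L2_set_def sum_nonneg)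
  have [measurable]: "(\<lambda>x. u x $ m) \<in> borel_measurable lebesgue" for m using L[of m] by (simp add: L2_def)
  have "(\<lambda>x. norm (u x)) \<in> borel_measurable lebesgue"
    unfolding norm_vec_def L2_set_def real_norm_def by measurable
  then show "(\<lambda>x. norm (u x)) \<in> L2" using L by (simp add: L2_def sq)
  have "(L2_norm (\<lambda>x. norm (u x)))\<^sup>2 = (\<Sum>m\<in>UNIV. (L2_norm (\<lambda>x. u x $ m))\<^sup>2)"
    using L by (simp add: L2_norm_sq sq L2_def)
  also have "\<dots> \<le> (\<Sum>m\<in>UNIV. (H2_norm (\<lambda>x. u x $ m))\<^sup>2)"
    by (intro sum_mono power_mono L2_norm_le_H2_norm) auto
  also have "\<dots> = (H2v_norm u)\<^sup>2" by (simp add: H2v_norm_eq L2_set_def sum_nonneg)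
  finally show "L2_norm (\<lambda>x. norm (u x)) \<le> H2v_norm u" by (rule power2_le_imp_le) simp
qed

section \<open>Convolution\<close>

lemma lborel_distr_minus: "distr lborel borel (\<lambda>y. x - y) = (lborel :: 'a::euclidean_space measure)"
  by (subst (2) lborel_affine[of "-1" x]) (auto simp: density_1)

lemma lborel_distr_translate: "distr lborel borel (\<lambda>x. x + y) = (lborel :: 'a::euclidean_space measure)"
proof -
  have "(\<lambda>x. x + y) = (+) y" by (auto simp: fun_eq_iff add.commute)
  then show ?thesis by (simp only: lborel_distr_plus)
qed

lemma lborel_minus:
  fixes f :: "'a::euclidean_space \<Rightarrow> real"
  assumes [measurable]: "f \<in> borel_measurable borel"
  shows "integrable lborel (\<lambda>y. f (x - y)) \<longleftrightarrow> integrable lborel f"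
    "(\<integral>y. f (x - y) \<partial>lborel) = (\<integral>y. f y \<partial>lborel)"
  using integrable_distr_eq[of "\<lambda>y. x - y" lborel borel f]
    integral_distr[of "\<lambda>y. x - y" lborel borel f]
  by (simp_all add: lborel_distr_minus)

lemma lborel_translate:
  fixes f :: "'a::euclidean_space \<Rightarrow> real"
  assumes [measurable]: "f \<in> borel_measurable borel"
  shows "integrable lborel (\<lambda>x. f (x + y)) \<longleftrightarrow> integrable lborel f"
    "(\<integral>x. f (x + y) \<partial>lborel) = (\<integral>x. f x \<partial>lborel)"
  using integrable_distr_eq[of "\<lambda>x. x + y" lborel borel f]
    integral_distr[of "\<lambda>x. x + y" lborel borel f]
  by (simp_all add: lborel_distr_translate)

lemma AE_lborel_minus:
  fixes x :: "'a::euclidean_space"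
  assumes "AE z in lborel. P z"
  shows "AE y in lborel. P (x - y)"
proof (rule AE_distrD[where M' = borel and f = "\<lambda>y. x - y"])
  show "AE z in distr lborel borel (\<lambda>y. x - y). P z"
    unfolding lborel_distr_minus by (rule assms)
qed simp

text \<open>The pair is ordered as \<open>(y, x)\<close>: integrating over \<open>x\<close> first leaves \<open>G\<close> times the constant \<open>\<integral>\<bar>k\<bar>\<close>.
  Applied to \<open>G\<^sup>2\<close> this controls every double integral that occurs below.\<close>
lemma convolution_kernel_integrable:
  fixes k G :: "'a::euclidean_space \<Rightarrow> real"
  assumes k: "integrable lborel k" and G: "integrable lborel G"
  shows "integrable (lborel \<Otimes>\<^sub>M lborel) (\<lambda>(y, x). k (x - y) * G y)"
proof (rule lborel_pair.Fubini_integrable)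
  have [measurable]: "k \<in> borel_measurable borel" "G \<in> borel_measurable borel"
    using k G by auto
  show "(\<lambda>(y, x). k (x - y) * G y) \<in> borel_measurable (lborel \<Otimes>\<^sub>M lborel)"
    by measurable
  have "(\<integral>x. norm (k (x - y) * G y) \<partial>lborel) = (\<integral>x. \<bar>k x\<bar> \<partial>lborel) * \<bar>G y\<bar>" for y
    using lborel_translate(2)[of "\<lambda>x. \<bar>k x\<bar>" "- y"] by (simp add: abs_mult)
  then show "integrable lborel (\<lambda>y. \<integral>x. norm (case (y, x) of (y, x) \<Rightarrow> k (x - y) * G y) \<partial>lborel)"
    using G by simp
  show "AE y in lborel. integrable lborel (\<lambda>x. case (y, x) of (y, x) \<Rightarrow> k (x - y) * G y)"
    using lborel_translate(1)[of k] k by (auto intro!: AE_I2 simp: diff_conv_add_uminus simp del: add_uminus_conv_diff)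
qed

definition conv :: "(real^'n \<Rightarrow> real) \<Rightarrow> (real^'n \<Rightarrow> real) \<Rightarrow> real^'n \<Rightarrow> real" where
  "conv K G x = (\<integral>y. K (x - y) * G y \<partial>lebesgue)"

lemma lebesgue_eq_lborel:
  fixes f :: "real^'n \<Rightarrow> real"
  assumes "f \<in> borel_measurable borel"
  shows "f \<in> borel_measurable lebesgue" "integrable lebesgue f \<longleftrightarrow> integrable lborel f"
    "integral\<^sup>L lebesgue f = integral\<^sup>L lborel f"
  using assms by (auto simp: integrable_completion integral_completion intro: measurable_completion)

text \<open>The Cauchy-Schwarz inequality for \<open>sqrt \<bar>k (x - y)\<bar>\<close> and \<open>sqrt \<bar>k (x - y)\<bar> * \<bar>G y\<bar>\<close> as
  functions of \<open>y\<close>. Integrating the result over \<open>x\<close> yields Young's inequality.\<close>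
lemma conv_pointwise:
  fixes k G :: "real^'n \<Rightarrow> real"
  assumes [measurable]: "k \<in> borel_measurable borel" "G \<in> borel_measurable borel"
    and k: "integrable lborel k"
    and x: "integrable lborel (\<lambda>y. \<bar>k (x - y)\<bar> * (G y)\<^sup>2)"
  shows "integrable lebesgue (\<lambda>y. k (x - y) * G y)"
    "(conv k G x)\<^sup>2 \<le> (\<integral>y. \<bar>k y\<bar> \<partial>lborel) * (\<integral>y. \<bar>k (x - y)\<bar> * (G y)\<^sup>2 \<partial>lborel)"
proof -
  define a where "a y = sqrt \<bar>k (x - y)\<bar>" for y
  define b where "b y = sqrt \<bar>k (x - y)\<bar> * \<bar>G y\<bar>" for y
  have [measurable]: "a \<in> borel_measurable borel" "b \<in> borel_measurable borel"
    by (auto simp: a_def[abs_def] b_def[abs_def])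
  have a2: "(a y)\<^sup>2 = \<bar>k (x - y)\<bar>" and b2: "(b y)\<^sup>2 = \<bar>k (x - y)\<bar> * (G y)\<^sup>2"
    and ab: "a y * b y = \<bar>k (x - y) * G y\<bar>" for y
    by (simp_all add: a_def b_def power_mult_distrib abs_mult flip: mult.assoc)
  have ki: "integrable lborel (\<lambda>y. \<bar>k (x - y)\<bar>)"
    using lborel_minus(1)[of "\<lambda>y. \<bar>k y\<bar>" x] k by simp
  have aL: "a \<in> L2" and bL: "b \<in> L2"
    using ki x by (simp_all add: L2_def a2 b2 lebesgue_eq_lborel)
  have i: "integrable lebesgue (\<lambda>y. \<bar>k (x - y) * G y\<bar>)"
    using L2_integrable_mult[OF aL bL] by (simp add: ab)
  have m: "(\<lambda>y. k (x - y) * G y) \<in> borel_measurable lebesgue" by (rule lebesgue_eq_lborel) measurable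
  show "integrable lebesgue (\<lambda>y. k (x - y) * G y)"
    using integrable_abs_cancel[OF i] m by simp
  have na: "(L2_norm a)\<^sup>2 = (\<integral>y. \<bar>k y\<bar> \<partial>lborel)"
    using lborel_minus(2)[of "\<lambda>y. \<bar>k y\<bar>" x] by (simp add: L2_norm_sq a2 lebesgue_eq_lborel)
  have nb: "(L2_norm b)\<^sup>2 = (\<integral>y. \<bar>k (x - y)\<bar> * (G y)\<^sup>2 \<partial>lborel)"
    by (simp add: L2_norm_sq b2 lebesgue_eq_lborel)
  have "\<bar>conv k G x\<bar> \<le> (\<integral>y. \<bar>k (x - y) * G y\<bar> \<partial>lebesgue)"
    unfolding conv_def by (rule integral_abs_bound)
  also have "\<dots> \<le> L2_norm a * L2_norm b"
    using L2_Cauchy_Schwarz[OF aL bL] by (simp add: ab)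
  finally have "\<bar>conv k G x\<bar>\<^sup>2 \<le> (L2_norm a * L2_norm b)\<^sup>2" by (rule power_mono) simp
  then show "(conv k G x)\<^sup>2 \<le> (\<integral>y. \<bar>k y\<bar> \<partial>lborel) * (\<integral>y. \<bar>k (x - y)\<bar> * (G y)\<^sup>2 \<partial>lborel)"
    by (simp add: power_mult_distrib na nb)
qed

text \<open>Young's inequality. Borel functions come first because \<open>(x, y) \<mapsto> k (x - y)\<close> is measurable for the
  product \<open>\<sigma>\<close>-algebra when \<open>k\<close> is Borel, but not in general when \<open>k\<close> is Lebesgue measurable.\<close>
lemma conv_borel:
  fixes k G :: "real^'n \<Rightarrow> real"
  assumes [measurable]: "k \<in> borel_measurable borel" "G \<in> borel_measurable borel"
    and k: "integrable lborel k" and G: "integrable lborel (\<lambda>y. (G y)\<^sup>2)"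
  shows "AE x in lebesgue. integrable lebesgue (\<lambda>y. k (x - y) * G y)"
    "conv k G \<in> L2" "L2_norm (conv k G) \<le> L1_norm k * L2_norm G"
proof -
  define N where "N x = (\<integral>y. \<bar>k (x - y)\<bar> * (G y)\<^sup>2 \<partial>lborel)" for x
  let ?k = "\<integral>y. \<bar>k y\<bar> \<partial>lborel"
  have "integrable lborel (\<lambda>y. \<bar>k y\<bar>)" using k by simp
  note P = convolution_kernel_integrable[OF this G]
  note P' = lborel_pair.AE_integrable_snd[OF P] lborel_pair.integrable_snd[OF P]
    lborel_pair.Fubini_integral[OF P]
  have ae: "AE x in lborel. integrable lborel (\<lambda>y. \<bar>k (x - y)\<bar> * (G y)\<^sup>2)" using P' by simp
  show "AE x in lebesgue. integrable lebesgue (\<lambda>y. k (x - y) * G y)"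
    using AE_completion[OF ae] by eventually_elim (intro conv_pointwise k; simp)
  have Ni: "integrable lborel N" using P' by (simp add: N_def[abs_def])
  have "(\<integral>x. N x \<partial>lborel) = (\<integral>y. \<integral>x. \<bar>k (x - y)\<bar> * (G y)\<^sup>2 \<partial>lborel \<partial>lborel)"
    using P' by (simp add: N_def[abs_def])
  also have "\<dots> = ?k * (\<integral>y. (G y)\<^sup>2 \<partial>lborel)"
    using lborel_translate(2)[of "\<lambda>x. \<bar>k x\<bar>" "- y" for y] by simp
  finally have NI: "(\<integral>x. N x \<partial>lborel) = ?k * (\<integral>y. (G y)\<^sup>2 \<partial>lborel)" .
  have conv_eq: "conv k G x = (\<integral>y. k (x - y) * G y \<partial>lborel)" for x
    unfolding conv_def by (rule lebesgue_eq_lborel) measurable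
  have [measurable]: "conv k G \<in> borel_measurable borel"
    unfolding conv_eq[abs_def] by measurable
  have le: "AE x in lborel. (conv k G x)\<^sup>2 \<le> ?k * N x"
    using ae unfolding N_def by eventually_elim (intro conv_pointwise k; simp)
  have k0: "0 \<le> ?k" by simp
  have sq: "integrable lborel (\<lambda>x. (conv k G x)\<^sup>2)"
  proof (rule Bochner_Integration.integrable_bound)
    show "integrable lborel (\<lambda>x. ?k * N x)" using Ni by simp
    show "AE x in lborel. norm ((conv k G x)\<^sup>2) \<le> norm (?k * N x)"
      using le by eventually_elim (smt (verit) real_norm_def zero_le_power2)
  qed measurable
  show "conv k G \<in> L2" by (simp add: L2_def lebesgue_eq_lborel sq)
  have "(L2_norm (conv k G))\<^sup>2 = (\<integral>x. (conv k G x)\<^sup>2 \<partial>lborel)"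
    by (simp add: L2_norm_sq lebesgue_eq_lborel)
  also have "\<dots> \<le> (\<integral>x. ?k * N x \<partial>lborel)"
    by (rule integral_mono_AE) (use sq Ni le in auto)
  also have "\<dots> = (L1_norm k * L2_norm G)\<^sup>2"
    by (simp add: NI power_mult_distrib L2_norm_sq L1_norm_def lebesgue_eq_lborel
        power2_eq_square[of "LBINT y. \<bar>k y\<bar>"] mult.assoc)
  finally show "L2_norm (conv k G) \<le> L1_norm k * L2_norm G"
    by (rule power2_le_imp_le) (simp add: L1_norm_def)
qed

text \<open>The triple product is dominated by \<open>\<bar>k (x - y)\<bar> * ((G y)\<^sup>2 + (\<psi> x)\<^sup>2)\<close>. The second summand is
  the first one for the reflected kernel with the two variables exchanged.\<close>
lemma conv_borel_Fubini:
  fixes k G \<psi> :: "real^'n \<Rightarrow> real"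
  assumes [measurable]: "k \<in> borel_measurable borel" "G \<in> borel_measurable borel"
      "\<psi> \<in> borel_measurable borel"
    and k: "integrable lborel k" and G: "integrable lborel (\<lambda>y. (G y)\<^sup>2)"
    and \<psi>: "integrable lborel (\<lambda>y. (\<psi> y)\<^sup>2)"
  shows "(\<integral>x. conv k G x * \<psi> x \<partial>lborel) = (\<integral>y. G y * (\<integral>x. k x * \<psi> (x + y) \<partial>lborel) \<partial>lborel)"
proof -
  have "integrable lborel (\<lambda>y. \<bar>k y\<bar>)" using k by simp
  note P = convolution_kernel_integrable[OF this G]
  have "integrable lborel (\<lambda>y. \<bar>k (- y)\<bar>)" using lborel_minus(1)[of "\<lambda>y. \<bar>k y\<bar>" 0] k by simp
  note Q = lborel_pair.integrable_product_swap[OF convolution_kernel_integrable[OF this \<psi>]]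
  have R: "integrable (lborel \<Otimes>\<^sub>M lborel) (\<lambda>(y, x). k (x - y) * G y * \<psi> x)"
  proof (rule Bochner_Integration.integrable_bound)
    show "integrable (lborel \<Otimes>\<^sub>M lborel) (\<lambda>(y, x). \<bar>k (x - y)\<bar> * (G y)\<^sup>2 + \<bar>k (x - y)\<bar> * (\<psi> x)\<^sup>2)"
      using Bochner_Integration.integrable_add[OF P Q] by (simp add: case_prod_unfold)
    have "\<bar>c\<bar> * \<bar>a * b\<bar> \<le> \<bar>c\<bar> * (a\<^sup>2 + b\<^sup>2)" for a b c :: real
      by (intro mult_left_mono abs_mult_le_sum_squares) auto
    then show "AE z in lborel \<Otimes>\<^sub>M lborel. norm (case z of (y, x) \<Rightarrow> k (x - y) * G y * \<psi> x)
        \<le> norm (case z of (y, x) \<Rightarrow> \<bar>k (x - y)\<bar> * (G y)\<^sup>2 + \<bar>k (x - y)\<bar> * (\<psi> x)\<^sup>2)"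
      by (intro AE_I2) (auto simp: abs_mult mult.assoc distrib_left[symmetric])
  qed measurable
  have conv_eq: "conv k G x = (\<integral>y. k (x - y) * G y \<partial>lborel)" for x
    unfolding conv_def by (rule lebesgue_eq_lborel) measurable
  have "(\<integral>x. conv k G x * \<psi> x \<partial>lborel) = (\<integral>x. \<integral>y. k (x - y) * G y * \<psi> x \<partial>lborel \<partial>lborel)"
    by (simp add: conv_eq)
  also have "\<dots> = (\<integral>y. \<integral>x. k (x - y) * G y * \<psi> x \<partial>lborel \<partial>lborel)"
    by (rule lborel_pair.Fubini_integral[OF R])
  also have "\<dots> = (\<integral>y. G y * (\<integral>x. k x * \<psi> (x + y) \<partial>lborel) \<partial>lborel)"
  proof (intro Bochner_Integration.integral_cong refl)
    fix y
    have "(\<integral>x. k (x - y) * G y * \<psi> x \<partial>lborel) = G y * (\<integral>x. k (x - y) * \<psi> x \<partial>lborel)"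
      by (simp add: mult_ac flip: integral_mult_right_zero)
    also have "(\<integral>x. k (x - y) * \<psi> x \<partial>lborel) = (\<integral>x. k x * \<psi> (x + y) \<partial>lborel)"
      using lborel_translate(2)[of "\<lambda>x. k (x - y) * \<psi> x" y] by simp
    finally show "(\<integral>x. k (x - y) * G y * \<psi> x \<partial>lborel) = G y * (\<integral>x. k x * \<psi> (x + y) \<partial>lborel)" .
  qed
  finally show ?thesis .
qed

text \<open>Reflections and translations preserve null sets, so passing to Borel versions changes no value
  of the convolution, at any point.\<close>
lemma conv_cong_AE:
  fixes K k G G' :: "real^'n \<Rightarrow> real"
  assumes k: "k \<in> borel_measurable borel" "AE x in lborel. K x = k x"
    and G: "G' \<in> borel_measurable borel" "AE x in lborel. G x = G' x"
  shows "conv K G = conv k G'"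
    "integrable lebesgue (\<lambda>y. k (x - y) * G' y) \<Longrightarrow> integrable lebesgue (\<lambda>y. K (x - y) * G y)"
proof -
  have ae: "AE y in lebesgue. k (x - y) * G' y = K (x - y) * G y" for x
    using AE_completion[OF AE_lborel_minus[OF k(2)], of x] AE_completion[OF G(2)] by eventually_elim simp
  have m: "(\<lambda>y. k (x - y) * G' y) \<in> borel_measurable lebesgue" for x
  proof -
    note [measurable] = k(1) G(1)
    show ?thesis by (rule lebesgue_eq_lborel(1)) measurable
  qed
  note m' = borel_measurable_AE[OF m ae]
  show "conv K G = conv k G'"
  proof
    fix x show "conv K G x = conv k G' x"
      unfolding conv_def using ae[of x] by (intro integral_cong_AE m m') auto
  qed
  show "integrable lebesgue (\<lambda>y. K (x - y) * G y)" if "integrable lebesgue (\<lambda>y. k (x - y) * G' y)"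
    using lebesgue_cong_AE(1)[OF that ae] .
qed

lemma borel_version:
  fixes f :: "real^'n \<Rightarrow> real"
  assumes "f \<in> borel_measurable lebesgue"
  obtains f' where "f' \<in> borel_measurable borel" "AE x in lborel. f x = f' x"
  using completion_ex_borel_measurable_real[OF assms] by auto

lemma borel_version_L1:
  fixes f :: "real^'n \<Rightarrow> real"
  assumes f: "f \<in> L1"
  obtains f' where "f' \<in> borel_measurable borel" "AE x in lborel. f x = f' x"
    "integrable lborel f'" "L1_norm f' = L1_norm f"
proof -
  have i: "integrable lebesgue f" using f by (simp add: L1_def)
  obtain f' where f': "f' \<in> borel_measurable borel" "AE x in lborel. f x = f' x"
    using borel_version[OF borel_measurable_integrable[OF i]] .
  note ae = AE_completion[OF f'(2)]
  have "integrable lborel f'"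
    using lebesgue_cong_AE(1)[OF i ae] f'(1) by (simp add: lebesgue_eq_lborel)
  moreover have "L1_norm f' = L1_norm f"
    unfolding L1_norm_def by (rule lebesgue_cong_AE(2)) (use i ae in auto)
  ultimately show ?thesis using f' that by blast
qed

lemma borel_version_L2:
  fixes f :: "real^'n \<Rightarrow> real"
  assumes f: "f \<in> L2"
  obtains f' where "f' \<in> borel_measurable borel" "AE x in lborel. f x = f' x"
    "integrable lborel (\<lambda>x. (f' x)\<^sup>2)" "L2_norm f' = L2_norm f"
proof -
  obtain f' where f': "f' \<in> borel_measurable borel" "AE x in lborel. f x = f' x"
    using borel_version[of f] f by (auto simp: L2_def)
  note c = L2_cong_AE[OF f AE_completion[OF f'(2)]]
  have "(\<lambda>x. (f' x)\<^sup>2) \<in> borel_measurable borel" using f'(1) by measurable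
  then have "integrable lborel (\<lambda>x. (f' x)\<^sup>2)" using c(1) by (simp add: L2_def lebesgue_eq_lborel(2))
  then show ?thesis using f' c(2) that by blast
qed

lemma conv_L2:
  assumes "K \<in> L1" "G \<in> L2"
  shows "AE x in lebesgue. integrable lebesgue (\<lambda>y. K (x - y) * G y)"
    "conv K G \<in> L2" "L2_norm (conv K G) \<le> L1_norm K * L2_norm G"
proof -
  obtain k where k: "k \<in> borel_measurable borel" "AE x in lborel. K x = k x"
    "integrable lborel k" "L1_norm k = L1_norm K" using borel_version_L1[OF assms(1)] .
  obtain G' where G: "G' \<in> borel_measurable borel" "AE x in lborel. G x = G' x"
    "integrable lborel (\<lambda>x. (G' x)\<^sup>2)" "L2_norm G' = L2_norm G" using borel_version_L2[OF assms(2)] .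
  note c = conv_cong_AE[OF k(1,2) G(1,2)]
  note b = conv_borel[OF k(1) G(1) k(3) G(3)]
  show "AE x in lebesgue. integrable lebesgue (\<lambda>y. K (x - y) * G y)"
    using b(1) by eventually_elim (rule c(2))
  show "conv K G \<in> L2" "L2_norm (conv K G) \<le> L1_norm K * L2_norm G"
    using b(2,3) by (simp_all add: c(1) k(4) G(4))
qed

lemma conv_Fubini:
  fixes K G \<psi> :: "real^'n \<Rightarrow> real"
  assumes "K \<in> L1" "G \<in> L2" and \<psi>: "continuous_on UNIV \<psi>" "\<psi> \<in> L2"
  shows "(\<integral>x. conv K G x * \<psi> x \<partial>lebesgue) = (\<integral>y. G y * (\<integral>x. K x * \<psi> (x + y) \<partial>lebesgue) \<partial>lebesgue)"
proof -
  obtain k where k: "k \<in> borel_measurable borel" "AE x in lborel. K x = k x"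
    "integrable lborel k" "L1_norm k = L1_norm K" using borel_version_L1[OF assms(1)] .
  obtain G' where G: "G' \<in> borel_measurable borel" "AE x in lborel. G x = G' x"
    "integrable lborel (\<lambda>x. (G' x)\<^sup>2)" "L2_norm G' = L2_norm G" using borel_version_L2[OF assms(2)] .
  note [measurable] = k(1) G(1)
  note c = conv_cong_AE[OF k(1,2) G(1,2)]
  have [measurable]: "\<psi> \<in> borel_measurable borel" using \<psi>(1) by (rule borel_measurable_continuous_onI)
  have \<psi>i: "integrable lborel (\<lambda>x. (\<psi> x)\<^sup>2)" using \<psi>(2) by (simp add: L2_def lebesgue_eq_lborel)
  have inner: "(\<integral>x. K x * \<psi> (x + y) \<partial>lebesgue) = (\<integral>x. k x * \<psi> (x + y) \<partial>lborel)" for y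
  proof -
    have m: "(\<lambda>x. k x * \<psi> (x + y)) \<in> borel_measurable borel" by measurable
    have ae: "AE x in lebesgue. k x * \<psi> (x + y) = K x * \<psi> (x + y)"
      using AE_completion[OF k(2)] by eventually_elim simp
    have "(\<integral>x. K x * \<psi> (x + y) \<partial>lebesgue) = (\<integral>x. k x * \<psi> (x + y) \<partial>lebesgue)"
      using ae by (intro integral_cong_AE borel_measurable_AE[OF lebesgue_eq_lborel(1)[OF m] ae]
          lebesgue_eq_lborel(1)[OF m]) auto
    then show ?thesis by (simp add: lebesgue_eq_lborel(3)[OF m])
  qed
  have m: "(\<lambda>y. G' y * (\<integral>x. k x * \<psi> (x + y) \<partial>lborel)) \<in> borel_measurable borel"
    by measurable
  have ae: "AE y in lebesgue. G' y * (\<integral>x. k x * \<psi> (x + y) \<partial>lborel) = G y * (\<integral>x. k x * \<psi> (x + y) \<partial>lborel)"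
    using AE_completion[OF G(2)] by eventually_elim simp
  have conv_eq: "conv k G' x = (\<integral>y. k (x - y) * G' y \<partial>lborel)" for x
    unfolding conv_def by (rule lebesgue_eq_lborel) measurable
  have cm: "(\<lambda>x. conv k G' x * \<psi> x) \<in> borel_measurable borel"
    unfolding conv_eq by measurable
  have "(\<integral>x. conv K G x * \<psi> x \<partial>lebesgue) = (\<integral>x. conv k G' x * \<psi> x \<partial>lborel)"
    by (simp add: c(1) lebesgue_eq_lborel(3)[OF cm])
  also have "\<dots> = (\<integral>y. G' y * (\<integral>x. k x * \<psi> (x + y) \<partial>lborel) \<partial>lborel)"
    by (rule conv_borel_Fubini) (use k G \<psi>i in simp_all)
  also have "\<dots> = (\<integral>y. G' y * (\<integral>x. k x * \<psi> (x + y) \<partial>lborel) \<partial>lebesgue)"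
    by (simp add: lebesgue_eq_lborel(3)[OF m])
  also have "\<dots> = (\<integral>y. G y * (\<integral>x. k x * \<psi> (x + y) \<partial>lborel) \<partial>lebesgue)"
    using ae by (intro integral_cong_AE borel_measurable_AE[OF lebesgue_eq_lborel(1)[OF m] ae]
        lebesgue_eq_lborel(1)[OF m]) auto
  finally show ?thesis by (simp add: inner)
qed

text \<open>The Laplacian falls on the kernel: by Fubini, testing the convolution against \<open>\<Delta>\<phi>\<close> tests \<open>K\<close>
  against \<open>\<Delta>\<close> of the translates of \<open>\<phi>\<close>, which are test functions again.\<close>
lemma conv_weak_laplacian:
  assumes K: "K \<in> L1" and D: "D \<in> L1" and G: "G \<in> L2" and w: "is_weak_laplacian K D"
  shows "is_weak_laplacian (conv K G) (conv D G)"
  unfolding is_weak_laplacian_def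
proof (intro conjI allI impI)
  show "loc_integrable (conv K G)" "loc_integrable (conv D G)"
    using conv_L2(2)[OF K G] conv_L2(2)[OF D G] by (auto intro: L2_loc_integrable)
  fix \<phi> :: "real^'a \<Rightarrow> real" assume \<phi>: "test_function \<phi>"
  obtain S where S: "compact S" "\<And>x. x \<notin> S \<Longrightarrow> \<phi> x = 0" "\<And>x. x \<notin> S \<Longrightarrow> laplacian \<phi> x = 0"
    "continuous_on UNIV \<phi>" "continuous_on UNIV (laplacian \<phi>)"
    using test_function_support[OF \<phi>] by blast
  note \<phi>L = continuous_compact_support_L2[OF S(4,1,2)] continuous_compact_support_L2[OF S(5,1,3)]
  have "(\<integral>x. conv K G x * laplacian \<phi> x \<partial>lebesgue)
      = (\<integral>y. G y * (\<integral>x. K x * laplacian (\<lambda>x. \<phi> (x + y)) x \<partial>lebesgue) \<partial>lebesgue)"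
    unfolding laplacian_translate by (rule conv_Fubini[OF K G S(5) \<phi>L(2)])
  also have "\<dots> = (\<integral>y. G y * (\<integral>x. D x * \<phi> (x + y) \<partial>lebesgue) \<partial>lebesgue)"
    using w test_function_translate[OF \<phi>] by (simp add: is_weak_laplacian_def)
  also have "\<dots> = (\<integral>x. conv D G x * \<phi> x \<partial>lebesgue)"
    by (rule conv_Fubini[OF D G S(4) \<phi>L(1), symmetric])
  finally show "(\<integral>x. conv K G x * laplacian \<phi> x \<partial>lebesgue) = (\<integral>x. conv D G x * \<phi> x \<partial>lebesgue)" .
qed

lemma W21D:
  fixes f :: "real^'n \<Rightarrow> real"
  assumes "f \<in> W21"
  shows "f \<in> L1" "weak_laplacian f \<in> L1" "is_weak_laplacian f (weak_laplacian f)"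
proof -
  obtain h where h: "h \<in> L1" "is_weak_laplacian f h" using assms by (auto simp: W21_def)
  show "f \<in> L1" using assms by (simp add: W21_def)
  show "weak_laplacian f \<in> L1"
    using lebesgue_cong_AE(1)[OF _ weak_laplacian_unique(2)[OF h(2)]] h(1) by (simp add: L1_def)
  show "is_weak_laplacian f (weak_laplacian f)" by (rule weak_laplacian_unique(1)[OF h(2)])
qed

text \<open>Young's inequality for the kernel and for its Laplacian. All smoothness comes from the kernel, so
  \<open>G\<close>, which will carry the nonlinearity, is measured in the \<open>L2\<close> norm.\<close>
lemma conv_H2:
  assumes K: "K \<in> W21" and G: "G \<in> L2"
  shows "conv K G \<in> H2" "H2_norm (conv K G) \<le> W21_norm K * L2_norm G"
proof -
  note KD = W21D[OF K]
  note c = conv_L2(2,3)[OF KD(1) G] conv_L2(2,3)[OF KD(2) G]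
  note h = H2I[OF c(1,3) conv_weak_laplacian[OF KD(1,2) G KD(3)]]
  show "conv K G \<in> H2" by (rule h)
  have "H2_norm (conv K G) \<le> norm (L1_norm K * L2_norm G, L1_norm (weak_laplacian K) * L2_norm G)"
    unfolding h(2) by (intro norm_Pair_mono c) auto
  also have "\<dots> = norm (L2_norm G *\<^sub>R (L1_norm K, L1_norm (weak_laplacian K)))"
    by (simp add: mult.commute)
  also have "\<dots> = W21_norm K * L2_norm G"
    unfolding norm_scaleR by (simp add: W21_norm_def norm_Pair)
  finally show "H2_norm (conv K G) \<le> W21_norm K * L2_norm G" .
qed

lemma conv_diff:
  assumes "K \<in> L1" "G \<in> L2" "G' \<in> L2"
  shows "AE x in lebesgue. conv K (\<lambda>y. G y - G' y) x = conv K G x - conv K G' x"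
  using conv_L2(1)[OF assms(1,2)] conv_L2(1)[OF assms(1,3)]
  by eventually_elim (simp add: conv_def right_diff_distrib)

section \<open>The contraction principle\<close>

lemma H2v_cong_AE:
  assumes u: "u \<in> H2v" and ae: "AE x in lebesgue. u x = w x"
  shows "w \<in> H2v" "H2v_norm w = H2v_norm u"
proof -
  have a: "AE x in lebesgue. u x $ m = w x $ m" for m using ae by auto
  have h: "(\<lambda>x. u x $ m) \<in> H2" for m using u by (simp add: H2v_def)
  show "w \<in> H2v" "H2v_norm w = H2v_norm u"
    using H2_cong_AE[OF h a] by (simp_all add: H2v_def H2v_norm_eq)
qed

lemma H2v_diff_AE_iff:
  assumes "u \<in> H2v" "w \<in> H2v"
  shows "H2v_norm (\<lambda>x. u x - w x) = 0 \<longleftrightarrow> (AE x in lebesgue. u x = w x)"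
  using H2v_norm_eq_0[OF H2v_diff[OF assms]] H2v_norm_AE_0[of "\<lambda>x. u x - w x"] by auto

text \<open>Banach's fixed point theorem, where equality is equality almost everywhere. The contraction
  estimate at distance zero shows that the map respects null sets, which gives the direction from
  right to left of the equivalence.\<close>
lemma H2v_ball_fixed_point:
  fixes t :: "(real^'d \<Rightarrow> real^'N) \<Rightarrow> real^'d \<Rightarrow> real^'N"
  assumes \<rho>: "0 \<le> \<rho>" and q: "0 \<le> q" "q < 1"
    and self_map: "\<forall>v\<in>H2v_ball \<rho>. t v \<in> H2v_ball \<rho>"
    and contraction: "\<forall>v\<in>H2v_ball \<rho>. \<forall>w\<in>H2v_ball \<rho>.
        H2v_norm (\<lambda>x. t v x - t w x) \<le> q * H2v_norm (\<lambda>x. v x - w x)"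
  obtains u where "u \<in> H2v_ball \<rho>"
    "\<And>w. w \<in> H2v_ball \<rho> \<Longrightarrow> (AE x in lebesgue. t w x = w x) \<longleftrightarrow> (AE x in lebesgue. w x = u x)"
proof -
  note self = bspec[OF self_map] and contr = bspec[OF bspec[OF contraction]]
  have BH: "v \<in> H2v" if "v \<in> H2v_ball \<rho>" for v :: "real^'d \<Rightarrow> real^'N"
    using that by (simp add: H2v_ball_def)
  define s where "s n = (t ^^ n) (\<lambda>x. 0)" for n
  \<comment> \<open>a positive ratio, as the geometric completeness lemma divides by its powers\<close>
  define p where "p = max q (1/2)"
  have p: "0 < p" "p < 1" "q \<le> p" using q by (auto simp: p_def)
  have s0: "s 0 = (\<lambda>x. 0)" and sS: "s (Suc n) = t (s n)" for n by (simp_all add: s_def)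
  have sB: "s n \<in> H2v_ball \<rho>" for n
    by (induction n) (use \<rho> self in \<open>auto simp: s0 sS H2v_ball_def H2v_zero\<close>)
  have step: "H2v_norm (\<lambda>x. s (Suc n) x - s n x) \<le> H2v_norm (\<lambda>x. s 1 x - s 0 x) * p ^ n" for n
  proof (induction n)
    case (Suc n)
    have "H2v_norm (\<lambda>x. s (Suc (Suc n)) x - s (Suc n) x) \<le> q * H2v_norm (\<lambda>x. s (Suc n) x - s n x)"
      unfolding sS[of "Suc n"] using contr[OF sB[of "Suc n"] sB[of n]] by (simp add: sS)
    also have "\<dots> \<le> p * (H2v_norm (\<lambda>x. s 1 x - s 0 x) * p ^ n)"
      using p Suc by (intro mult_mono) auto
    finally show ?case by (simp add: mult_ac)
  qed simp
  obtain u where u: "u \<in> H2v" "(\<lambda>n. H2v_norm (\<lambda>x. u x - s n x)) \<longlonglongrightarrow> 0"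
    by (rule H2v_complete_geometric[where u = s, OF BH[OF sB] p(1,2) step])
  have uB: "u \<in> H2v_ball \<rho>"
  proof -
    have "H2v_norm u \<le> H2v_norm (\<lambda>x. u x - s n x) + \<rho>" for n
      using H2v_add(2)[OF H2v_diff[OF u(1) BH[OF sB[of n]]] BH[OF sB[of n]]] sB[of n]
      by (simp add: H2v_ball_def)
    moreover have "(\<lambda>n. H2v_norm (\<lambda>x. u x - s n x) + \<rho>) \<longlonglongrightarrow> 0 + \<rho>"
      by (intro tendsto_intros u)
    ultimately have "H2v_norm u \<le> 0 + \<rho>" by (intro LIMSEQ_le_const) auto
    with u show ?thesis by (simp add: H2v_ball_def)
  qed
  have fix_u: "H2v_norm (\<lambda>x. t u x - u x) = 0"
  proof -
    have "H2v_norm (\<lambda>x. t u x - u x) \<le> q * H2v_norm (\<lambda>x. u x - s n x) + H2v_norm (\<lambda>x. u x - s (Suc n) x)" for n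
    proof -
      note m = BH[OF self[OF uB]] BH[OF sB[of "Suc n"]]
      have "H2v_norm (\<lambda>x. t u x - u x) \<le> H2v_norm (\<lambda>x. t u x - s (Suc n) x) + H2v_norm (\<lambda>x. s (Suc n) x - u x)"
        using H2v_add(2)[OF H2v_diff[OF m] H2v_diff[OF m(2) u(1)]] by simp
      moreover have "H2v_norm (\<lambda>x. t u x - s (Suc n) x) \<le> q * H2v_norm (\<lambda>x. u x - s n x)"
        using contr[OF uB sB[of n]] by (simp add: sS)
      ultimately show ?thesis using H2v_norm_minus_commute[OF m(2) u(1)] by simp
    qed
    moreover have "(\<lambda>n. q * H2v_norm (\<lambda>x. u x - s n x) + H2v_norm (\<lambda>x. u x - s (Suc n) x)) \<longlonglongrightarrow> q * 0 + 0"
      by (intro tendsto_intros u LIMSEQ_Suc[OF u(2)])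
    ultimately have "H2v_norm (\<lambda>x. t u x - u x) \<le> q * 0 + 0" by (intro LIMSEQ_le_const) auto
    then show ?thesis using H2v_norm_nonneg[of "\<lambda>x. t u x - u x"] by linarith
  qed
  then have tu: "AE x in lebesgue. t u x = u x"
    using H2v_diff_AE_iff[OF BH[OF self[OF uB]] u(1)] by simp
  show ?thesis
  proof (rule that[OF uB])
    fix w :: "real^'d \<Rightarrow> real^'N" assume w: "w \<in> H2v_ball \<rho>"
    show "(AE x in lebesgue. t w x = w x) \<longleftrightarrow> (AE x in lebesgue. w x = u x)"
    proof
      assume tw: "AE x in lebesgue. t w x = w x"
      have "AE x in lebesgue. t w x - t u x = w x - u x" using tw tu by eventually_elim simp
      from H2v_cong_AE(2)[OF H2v_diff[OF BH[OF self[OF w]] BH[OF self[OF uB]]] this]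
      have "H2v_norm (\<lambda>x. w x - u x) \<le> q * H2v_norm (\<lambda>x. w x - u x)"
        using contr[OF w uB] by simp
      then have "(1 - q) * H2v_norm (\<lambda>x. w x - u x) \<le> 0" by (simp add: algebra_simps)
      then have "H2v_norm (\<lambda>x. w x - u x) = 0"
        using q H2v_norm_nonneg[of "\<lambda>x. w x - u x"] by (simp add: mult_le_0_iff)
      then show "AE x in lebesgue. w x = u x" using H2v_diff_AE_iff[OF BH[OF w] u(1)] by simp
    next
      assume wu: "AE x in lebesgue. w x = u x"
      then have "H2v_norm (\<lambda>x. w x - u x) = 0" using H2v_diff_AE_iff[OF BH[OF w] u(1)] by simp
      then have "H2v_norm (\<lambda>x. t w x - t u x) = 0"
        using contr[OF w uB] H2v_norm_nonneg[of "\<lambda>x. t w x - t u x"] by simp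
      then have "AE x in lebesgue. t w x = t u x"
        using H2v_diff_AE_iff[OF BH[OF self[OF w]] BH[OF self[OF uB]]] by simp
      with tu wu show "AE x in lebesgue. t w x = w x" by eventually_elim simp
    qed
  qed
qed

section \<open>Nonlinear maps on a compact convex set\<close>

lemma C_norm_upper:
  assumes "compact S" "continuous_on S f" "z \<in> S"
  shows "\<bar>f z\<bar> \<le> C_norm S f"
  unfolding C_norm_def
proof (rule cSUP_upper[OF assms(3)])
  have "compact ((\<lambda>z. \<bar>f z\<bar>) ` S)"
    by (intro compact_continuous_image continuous_intros assms)
  then show "bdd_above ((\<lambda>z. \<bar>f z\<bar>) ` S)" by (intro bounded_imp_bdd_above compact_imp_bounded)
qed

lemma C1_on_continuous: "C1_on S f \<Longrightarrow> continuous_on S f"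
  by (auto simp: C1_on_def continuous_on_eq_continuous_within
      intro: differentiable_imp_continuous_within)

lemma C1_norm_nonneg:
  assumes "compact S" "S \<noteq> {}" "C1_on S f"
  shows "0 \<le> C1_norm S f"
proof -
  obtain z where z: "z \<in> S" using assms by blast
  have "0 \<le> C_norm S h" if "continuous_on S h" for h
    using C_norm_upper[OF assms(1) that z] abs_ge_zero[of "h z"] by linarith
  then show ?thesis using assms(3) C1_on_continuous[OF assms(3)]
    by (auto simp: C1_norm_def C1_on_def intro!: add_nonneg_nonneg sum_nonneg)
qed

text \<open>The mean value inequality on a convex set. Each coordinate of a vector is at most its Euclidean
  norm, so the sum of the suprema of the partial derivatives bounds the operator norm of the
  derivative.\<close>
lemma C1_Lipschitz:
  fixes f :: "real^'N \<Rightarrow> real"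
  assumes S: "compact S" "convex S" and f: "C1_on S f" and zw: "z \<in> S" "w \<in> S"
  shows "\<bar>f z - f w\<bar> \<le> C1_norm S f * norm (z - w)"
proof -
  have C: "continuous_on S (partial_within S n f)" for n using f by (simp add: C1_on_def)
  have c0: "0 \<le> C_norm S f"
    using C_norm_upper[OF S(1) C1_on_continuous[OF f] zw(1)] abs_ge_zero[of "f z"] by linarith
  have "norm (f z - f w) \<le> C1_norm S f * norm (z - w)"
  proof (rule differentiable_bound[OF S(2) _ _ zw])
    fix x assume x: "x \<in> S"
    let ?D = "frechet_derivative f (at x within S)"
    show D: "(f has_derivative ?D) (at x within S)"
      using f x by (simp add: C1_on_def frechet_derivative_works)
    then have lin: "linear ?D" by (simp add: has_derivative_def bounded_linear.linear)
    show "onorm ?D \<le> C1_norm S f"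
    proof (rule onorm_le)
      fix h :: "real^'N"
      have "h = (\<Sum>n\<in>UNIV. h $ n *\<^sub>R axis n 1)"
        by (simp add: vec_eq_iff axis_def if_distrib[of "(*) _"] cong: if_cong)
      then have "?D h = (\<Sum>n\<in>UNIV. h $ n * partial_within S n f x)"
        using linear_sum[OF lin] linear_scale[OF lin]
        by (metis (mono_tags, lifting) partial_within_def real_scaleR_def sum.cong)
      also have "\<bar>\<dots>\<bar> \<le> (\<Sum>n\<in>UNIV. \<bar>h $ n\<bar> * \<bar>partial_within S n f x\<bar>)"
        by (rule order_trans[OF sum_abs]) (simp add: abs_mult)
      also have "\<dots> \<le> (\<Sum>n\<in>UNIV. norm h * C_norm S (partial_within S n f))"
        using C_norm_upper[OF S(1) C x] by (intro sum_mono mult_mono component_le_norm_cart) auto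
      also have "\<dots> \<le> C1_norm S f * norm h"
        unfolding C1_norm_def sum_distrib_left[symmetric] mult.commute[of _ "norm h"]
        using c0 by (intro mult_left_mono) auto
      finally show "norm (?D h) \<le> C1_norm S f * norm h" by simp
    qed
  qed
  then show ?thesis by simp
qed

lemma H2v_measurable:
  assumes "u \<in> H2v"
  shows "u \<in> borel_measurable lebesgue"
proof -
  have "(\<lambda>x. u x \<bullet> b) \<in> borel_measurable lebesgue" if b: "b \<in> Basis" for b
  proof -
    obtain m where "b = axis m 1" using b by (auto simp: Basis_vec_def)
    then have "(\<lambda>x. u x \<bullet> b) = (\<lambda>x. u x $ m)" by (simp add: inner_axis)
    then show ?thesis using assms H2D(1)[of "\<lambda>x. u x $ m"] by (simp add: H2v_def L2_def)
  qed
  then show ?thesis by (subst borel_measurable_euclidean_space) auto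
qed

text \<open>Outside \<open>S\<close> nothing is known about \<open>f\<close>, but the composition agrees almost everywhere with that of
  \<open>f\<close> cut off outside \<open>S\<close>, and Lebesgue measure is complete.\<close>
lemma continuous_on_closed_compose_measurable:
  fixes f :: "real^'N \<Rightarrow> real" and u :: "real^'d \<Rightarrow> real^'N"
  assumes "closed S" "continuous_on S f" "u \<in> borel_measurable lebesgue" "AE x in lebesgue. u x \<in> S"
  shows "(\<lambda>x. f (u x)) \<in> borel_measurable lebesgue"
proof (rule borel_measurable_AE)
  have "(\<lambda>z. indicator S z *\<^sub>R f z) \<in> borel_measurable borel"
    using assms by (intro borel_measurable_continuous_on_indicator) auto
  from measurable_compose[OF assms(3) this]
  show "(\<lambda>x. indicator S (u x) *\<^sub>R f (u x)) \<in> borel_measurable lebesgue" .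
  show "AE x in lebesgue. indicator S (u x) *\<^sub>R f (u x) = f (u x)"
    using assms(4) by eventually_elim simp
qed

lemma Lipschitz_compose_L2:
  fixes f :: "real^'N \<Rightarrow> real" and u w :: "real^'d \<Rightarrow> real^'N"
  assumes S: "closed S" and L: "0 \<le> L" "\<forall>z\<in>S. \<forall>z'\<in>S. \<bar>f z - f z'\<bar> \<le> L * norm (z - z')"
    and f: "continuous_on S f"
    and u: "u \<in> H2v" "AE x in lebesgue. u x \<in> S" and w: "w \<in> H2v" "AE x in lebesgue. w x \<in> S"
  shows "(\<lambda>x. f (u x) - f (w x)) \<in> L2"
    "L2_norm (\<lambda>x. f (u x) - f (w x)) \<le> L * H2v_norm (\<lambda>x. u x - w x)"
proof -
  note d = H2v_L2_norm[OF H2v_diff[OF u(1) w(1)]]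
  have m: "(\<lambda>x. f (u x) - f (w x)) \<in> borel_measurable lebesgue"
    by (intro borel_measurable_diff continuous_on_closed_compose_measurable[OF S f] H2v_measurable u w)
  have le: "AE x in lebesgue. \<bar>f (u x) - f (w x)\<bar> \<le> \<bar>L * norm (u x - w x)\<bar>"
    using u(2) w(2) by eventually_elim (use L in \<open>simp add: abs_mult\<close>)
  note r = L2_mono[OF L2_cmult[OF d(1)] m le]
  show "(\<lambda>x. f (u x) - f (w x)) \<in> L2" by (rule r(1))
  have "L2_norm (\<lambda>x. f (u x) - f (w x)) \<le> L * L2_norm (\<lambda>x. norm (u x - w x))"
    using r(2) L(1) by (simp add: L2_norm_cmult)
  also have "\<dots> \<le> L * H2v_norm (\<lambda>x. u x - w x)" using d(2) L(1) by (rule mult_left_mono)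
  finally show "L2_norm (\<lambda>x. f (u x) - f (w x)) \<le> L * H2v_norm (\<lambda>x. u x - w x)" .
qed

text \<open>The scalar embedding applied to each component and summed in quadrature keeps the same
  constant \<open>c\<close>. This is what places the argument of the nonlinearity in the ball on which it is
  controlled.\<close>
lemma H2v_AE_norm_le:
  fixes u :: "real^'d \<Rightarrow> real^'N"
  assumes emb: "\<forall>\<phi>\<in>H2. Linf_norm \<phi> \<le> ereal (c * H2_norm (\<phi> :: real^'d \<Rightarrow> real))"
    and c: "0 \<le> c" and u: "u \<in> H2v"
  shows "AE x in lebesgue. norm (u x) \<le> c * H2v_norm u"
proof -
  have "AE x in lebesgue. \<bar>u x $ m\<bar> \<le> c * H2_norm (\<lambda>x. u x $ m)" for m
  proof -
    have "(\<lambda>x. u x $ m) \<in> H2" using u by (simp add: H2v_def)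
    from bspec[OF emb this] have le: "esssup lebesgue (\<lambda>x. ereal \<bar>u x $ m\<bar>) \<le> ereal (c * H2_norm (\<lambda>x. u x $ m))"
      by (simp add: Linf_norm_def)
    show ?thesis using esssup_AE[of "\<lambda>x. ereal \<bar>u x $ m\<bar>" lebesgue]
    proof eventually_elim
      case (elim x)
      from order_trans[OF elim le] show ?case by simp
    qed
  qed
  then have "AE x in lebesgue. \<forall>m\<in>UNIV. \<bar>u x $ m\<bar> \<le> c * H2_norm (\<lambda>x. u x $ m)"
    by (subst AE_finite_all) auto
  then show ?thesis
  proof eventually_elim
    case (elim x)
    have "norm (u x) \<le> L2_set (\<lambda>m. c * H2_norm (\<lambda>x. u x $ m)) UNIV"
      unfolding norm_vec_def using elim by (intro L2_set_mono) auto
    also have "\<dots> = c * H2v_norm u" unfolding H2v_norm_eq using c by (rule L2_set_right_distrib[symmetric])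
    finally show ?case .
  qed
qed

section \<open>The fixed point map\<close>

lemma onorm_H2_bound:
  fixes T :: "(real^'n \<Rightarrow> real) \<Rightarrow> real^'n \<Rightarrow> real"
  assumes T: "bounded_linear_H2 T" and f: "f \<in> H2"
  shows "H2_norm (T f) \<le> onorm_H2 T * H2_norm f"
proof -
  obtain C where "\<forall>f\<in>H2. H2_norm (T f) \<le> C * H2_norm f"
    using T unfolding bounded_linear_H2_def by blast
  note C = bspec[OF this]
  have "bdd_above ((\<lambda>f. H2_norm (T f) / H2_norm f) ` H2)"
  proof (rule bdd_aboveI2)
    fix f :: "real^'n \<Rightarrow> real" assume f: "f \<in> H2"
    show "H2_norm (T f) / H2_norm f \<le> \<bar>C\<bar>"
    proof (cases "H2_norm f = 0")
      case False
      then have p: "0 < H2_norm f" using H2_norm_nonneg[of f] by linarith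
      have "C * H2_norm f \<le> \<bar>C\<bar> * H2_norm f" by (intro mult_right_mono) auto
      with C[OF f] have "H2_norm (T f) \<le> \<bar>C\<bar> * H2_norm f" by linarith
      with p show ?thesis by (simp add: divide_le_eq)
    qed simp
  qed
  then have le: "H2_norm (T f) / H2_norm f \<le> onorm_H2 T"
    unfolding onorm_H2_def by (intro cSUP_upper f)
  show ?thesis
  proof (cases "H2_norm f = 0")
    case True
    then show ?thesis using C[OF f] by simp
  next
    case False
    then have "0 < H2_norm f" using H2_norm_nonneg[of f] by linarith
    with le show ?thesis by (simp add: divide_le_eq)
  qed
qed

lemma bounded_linear_H2_diff:
  assumes T: "bounded_linear_H2 T" and f: "f \<in> H2" and h: "h \<in> H2"
  shows "AE x in lebesgue. T (\<lambda>y. f y - h y) x = T f x - T h x"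
proof -
  have h': "(\<lambda>y. -1 * h y) \<in> H2" using H2_lincomb(1)[OF h h, of "-1" 0] by simp
  have add: "\<forall>f\<in>H2. \<forall>h\<in>H2. AE x in lebesgue. T (\<lambda>y. f y + h y) x = T f x + T h x"
    and mult: "\<forall>c. \<forall>f\<in>H2. AE x in lebesgue. T (\<lambda>y. c * f y) x = c * T f x"
    using T by (auto simp: bounded_linear_H2_def)
  have "AE x in lebesgue. T (\<lambda>y. f y + -1 * h y) x = T f x + T (\<lambda>y. -1 * h y) x"
    by (rule bspec[OF bspec[OF add f] h'])
  moreover have "AE x in lebesgue. T (\<lambda>y. -1 * h y) x = -1 * T h x"
    by (rule bspec[OF spec[OF mult] h])
  ultimately show ?thesis by eventually_elim simp
qed

text \<open>The algebra property splits the product, the operator norm bounds one factor and the smoothing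
  estimate for the convolution bounds the other.\<close>
lemma H2_operator_mult_conv:
  fixes K :: "real^'d \<Rightarrow> real"
  assumes alg: "\<forall>\<phi>1\<in>H2. \<forall>\<phi>2\<in>H2. (\<lambda>x. \<phi>1 x * \<phi>2 x) \<in> H2 \<and>
      H2_norm (\<lambda>x. \<phi>1 x * \<phi>2 x) \<le> c * H2_norm \<phi>1 * H2_norm (\<phi>2 :: real^'d \<Rightarrow> real)"
    and c: "0 \<le> c" and T: "bounded_linear_H2 T" "0 \<le> onorm_H2 T" and K: "K \<in> W21"
    and f: "f \<in> H2" and G: "G \<in> L2"
  shows "(\<lambda>x. T f x * conv K G x) \<in> H2"
    "H2_norm (\<lambda>x. T f x * conv K G x) \<le> c * (onorm_H2 T * W21_norm K) * (H2_norm f * L2_norm G)"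
proof -
  have Tf: "T f \<in> H2" using T f by (simp add: bounded_linear_H2_def)
  note k = conv_H2[OF K G]
  show "(\<lambda>x. T f x * conv K G x) \<in> H2" using bspec[OF bspec[OF alg Tf] k(1)] by blast
  have "H2_norm (\<lambda>x. T f x * conv K G x) \<le> c * H2_norm (T f) * H2_norm (conv K G)"
    using bspec[OF bspec[OF alg Tf] k(1)] by blast
  also have "\<dots> \<le> c * (onorm_H2 T * H2_norm f) * (W21_norm K * L2_norm G)"
    using c T by (intro mult_mono mult_left_mono k onorm_H2_bound[OF T(1) f]) auto
  finally show "H2_norm (\<lambda>x. T f x * conv K G x) \<le> c * (onorm_H2 T * W21_norm K) * (H2_norm f * L2_norm G)"
    by (simp add: mult_ac)
qed

text \<open>The product rule for differences, \<open>a b - a' b' = (a - a') b + a' (b - b')\<close>, where linearity of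
  \<open>T\<close> and of the convolution turns both terms into products of the form just estimated.\<close>
lemma H2_operator_mult_conv_diff:
  fixes K :: "real^'d \<Rightarrow> real"
  assumes alg: "\<forall>\<phi>1\<in>H2. \<forall>\<phi>2\<in>H2. (\<lambda>x. \<phi>1 x * \<phi>2 x) \<in> H2 \<and>
      H2_norm (\<lambda>x. \<phi>1 x * \<phi>2 x) \<le> c * H2_norm \<phi>1 * H2_norm (\<phi>2 :: real^'d \<Rightarrow> real)"
    and c: "0 \<le> c" and T: "bounded_linear_H2 T" "0 \<le> onorm_H2 T" and K: "K \<in> W21"
    and f: "f \<in> H2" "f' \<in> H2" and G: "G \<in> L2" "G' \<in> L2"
  shows "H2_norm (\<lambda>x. T f x * conv K G x - T f' x * conv K G' x)
     \<le> c * (onorm_H2 T * W21_norm K) *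
        (H2_norm (\<lambda>x. f x - f' x) * L2_norm G + H2_norm f' * L2_norm (\<lambda>x. G x - G' x))"
proof -
  let ?d = "\<lambda>x. f x - f' x" and ?e = "\<lambda>x. G x - G' x"
  have d: "?d \<in> H2" using f by (rule H2_diff)
  have e: "?e \<in> L2" using G by (rule L2_diff)
  note b1 = H2_operator_mult_conv[OF alg c T K d G(1)] and b2 = H2_operator_mult_conv[OF alg c T K f(2) e]
  have "AE x in lebesgue. T ?d x * conv K G x + T f' x * conv K ?e x
      = T f x * conv K G x - T f' x * conv K G' x"
    using bounded_linear_H2_diff[OF T(1) f] conv_diff[OF W21D(1)[OF K] G]
  proof eventually_elim
    case (elim x)
    show ?case unfolding elim by (simp add: algebra_simps)
  qed
  from H2_cong_AE(2)[OF H2_add(1)[OF b1(1) b2(1)] this]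
  have "H2_norm (\<lambda>x. T f x * conv K G x - T f' x * conv K G' x)
      \<le> H2_norm (\<lambda>x. T ?d x * conv K G x) + H2_norm (\<lambda>x. T f' x * conv K ?e x)"
    using H2_add(2)[OF b1(1) b2(1)] by simp
  also have "\<dots> \<le> c * (onorm_H2 T * W21_norm K) * (H2_norm ?d * L2_norm G)
      + c * (onorm_H2 T * W21_norm K) * (H2_norm f' * L2_norm ?e)"
    by (rule add_mono[OF b1(2) b2(2)])
  finally show ?thesis by (simp add: distrib_left)
qed

lemma Q_const_eq: "Q_const T K = L2_set (\<lambda>m. onorm_H2 (T m) * W21_norm (K m)) UNIV"
  by (simp add: Q_const_def L2_set_def power_mult_distrib)

lemma t_map_component:
  "t_map T K u0 g v x $ m = T m (\<lambda>y. u0 y $ m + v y $ m) x * conv (K m) (\<lambda>y. g (u0 y + v y) $ m) x"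
  by (simp add: t_map_def conv_def)

theorem theorem1p3:
  fixes K :: "'N::finite \<Rightarrow> real^'d::finite \<Rightarrow> real"
    and u0 :: "real^'d \<Rightarrow> real^'N"
    and T :: "'N \<Rightarrow> (real^'d \<Rightarrow> real) \<Rightarrow> (real^'d \<Rightarrow> real)"
    and g :: "real^'N \<Rightarrow> real^'N"
    and c_e c_a \<rho> M :: real
  assumes "CARD('d) = 2 \<or> CARD('d) = 3"
    and "0 < \<rho>" "\<rho> \<le> 1" "M > 0"
    and "c_e > 0"
    and "\<And>\<phi> :: real^'d \<Rightarrow> real. \<phi> \<in> H2 \<Longrightarrow> Linf_norm \<phi> \<le> ereal (c_e * H2_norm \<phi>)"
    and "c_a > 0"
    and "\<And>\<phi>1 \<phi>2 :: real^'d \<Rightarrow> real. \<phi>1 \<in> H2 \<Longrightarrow> \<phi>2 \<in> H2 \<Longrightarrow>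
           (\<lambda>x. \<phi>1 x * \<phi>2 x) \<in> H2 \<and>
           H2_norm (\<lambda>x. \<phi>1 x * \<phi>2 x) \<le> c_a * H2_norm \<phi>1 * H2_norm \<phi>2"
    and "\<And>m. K m \<in> W21"
    and "\<And>m. \<not> (AE x in lebesgue. K m x = 0)"
    and "u0 \<in> H2v"
    and "\<exists>m. \<not> (AE x in lebesgue. u0 x $ m = 0)"
    and "\<And>m. bounded_linear_H2 (T m)"
    and "\<And>m. 0 < onorm_H2 (T m)"
    and "\<And>m. g 0 $ m = 0"
    and "g \<in> D_set (I_ball c_e u0) M"
    and "\<exists>z\<in>I_ball c_e u0. g z \<noteq> 0"
    and "c_a * M * (H2v_norm u0 + 1)\<^sup>2 * Q_const T K \<le> \<rho> / 2"
  shows "(\<forall>v\<in>H2v_ball \<rho>. t_map T K u0 g v \<in> H2v_ball \<rho>) \<and>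
    (\<exists>q. 0 \<le> q \<and> q < 1 \<and>
      (\<forall>v1\<in>H2v_ball \<rho>. \<forall>v2\<in>H2v_ball \<rho>.
        H2v_norm (\<lambda>x. t_map T K u0 g v1 x - t_map T K u0 g v2 x)
          \<le> q * H2v_norm (\<lambda>x. v1 x - v2 x))) \<and>
    (\<exists>u_p\<in>H2v_ball \<rho>.
      (AE x in lebesgue. t_map T K u0 g u_p x = u_p x) \<and>
      (\<forall>w\<in>H2v_ball \<rho>. (AE x in lebesgue. t_map T K u0 g w x = w x)
          \<longrightarrow> (AE x in lebesgue. w x = u_p x)) \<and>
      (\<forall>w\<in>H2v_ball \<rho>.
        (\<forall>m. AE x in lebesgue.
           w x $ m = T m (\<lambda>y. u0 y $ m + w y $ m) x
                       * (\<integral>y. K m (x - y) * g (u0 y + w y) $ m \<partial>lebesgue))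
        \<longleftrightarrow> (AE x in lebesgue. w x = u_p x)))"
proof -
  have emb: "\<forall>\<phi>\<in>H2. Linf_norm \<phi> \<le> ereal (c_e * H2_norm (\<phi> :: real^'d \<Rightarrow> real))"
    using assms(6) by blast
  have alg: "\<forall>\<phi>1\<in>H2. \<forall>\<phi>2\<in>H2. (\<lambda>x. \<phi>1 x * \<phi>2 x) \<in> H2 \<and>
      H2_norm (\<lambda>x. \<phi>1 x * \<phi>2 x) \<le> c_a * H2_norm \<phi>1 * H2_norm (\<phi>2 :: real^'d \<Rightarrow> real)"
    using assms(8) by blast
  note \<rho> = assms(2,3) and K = assms(9) and u0 = assms(11)
    and T = assms(13) less_imp_le[OF assms(14)]
  let ?t = "t_map T K u0 g" and ?S = "I_ball c_e u0"
  define A where "A = H2v_norm u0 + 1"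
  define Q where "Q = Q_const T K"
  have A: "1 \<le> A" by (simp add: A_def)
  \<comment> \<open>strict because \<open>u0\<close> is not zero; this is what makes the ratio below strictly less than one\<close>
  have A1: "1 < A"
  proof -
    have "H2v_norm u0 \<noteq> 0"
    proof
      assume "H2v_norm u0 = 0"
      from H2v_norm_eq_0[OF u0 this] have "AE x in lebesgue. u0 x $ m = 0" for m by auto
      with assms(12) show False by blast
    qed
    then show ?thesis using H2v_norm_nonneg[of u0] unfolding A_def by linarith
  qed
  have Q0: "0 \<le> Q" by (simp add: Q_def Q_const_eq)
  have W0: "0 \<le> onorm_H2 (T m) * W21_norm (K m)" for m
    using T(2)[of m] by (simp add: W21_norm_def)
  have S: "?S = cball 0 (c_e * A)" by (auto simp: I_ball_def A_def)
  have S0: "0 \<in> ?S" using assms(5) A by (simp add: S)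
  have C1: "C1_on ?S (\<lambda>z. g z $ m)" for m using assms(16) by (simp add: D_set_def)
  have gM: "C1_norm ?S (\<lambda>z. g z $ m) \<le> M" for m
  proof -
    have "C1_norm ?S (\<lambda>z. g z $ m) \<le> (\<Sum>m\<in>UNIV. C1_norm ?S (\<lambda>z. g z $ m))"
      using S0 by (intro member_le_sum C1_norm_nonneg C1) (auto simp: S)
    then show ?thesis using assms(16) by (simp add: D_set_def)
  qed
  have lip: "\<forall>z\<in>?S. \<forall>z'\<in>?S. \<bar>g z $ m - g z' $ m\<bar> \<le> M * norm (z - z')" for m
  proof (intro ballI)
    fix z z' assume z: "z \<in> ?S" "z' \<in> ?S"
    have "\<bar>g z $ m - g z' $ m\<bar> \<le> C1_norm ?S (\<lambda>z. g z $ m) * norm (z - z')"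
      by (rule C1_Lipschitz[OF _ _ C1 z]) (auto simp: S)
    also have "\<dots> \<le> M * norm (z - z')" by (intro mult_right_mono gM) simp
    finally show "\<bar>g z $ m - g z' $ m\<bar> \<le> M * norm (z - z')" .
  qed
  note comp = Lipschitz_compose_L2[where S = ?S and L = M, OF _ _ lip C1_on_continuous[OF C1]]
  have in_ball: "(\<lambda>x. u0 x + v x) \<in> H2v" "H2v_norm (\<lambda>x. u0 x + v x) \<le> A"
      "AE x in lebesgue. u0 x + v x \<in> ?S" if "v \<in> H2v_ball \<rho>" for v
  proof -
    have v: "v \<in> H2v" "H2v_norm v \<le> 1" using that \<rho> by (auto simp: H2v_ball_def)
    show w: "(\<lambda>x. u0 x + v x) \<in> H2v" by (rule H2v_add(1)[OF u0 v(1)])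
    show n: "H2v_norm (\<lambda>x. u0 x + v x) \<le> A" using H2v_add(2)[OF u0 v(1)] v(2) by (simp add: A_def)
    have "c_e * H2v_norm (\<lambda>x. u0 x + v x) \<le> c_e * A" using n assms(5) by simp
    then show "AE x in lebesgue. u0 x + v x \<in> ?S"
      using H2v_AE_norm_le[OF emb less_imp_le[OF assms(5)] w] by (auto simp: S)
  qed
  have f: "(\<lambda>y. u0 y $ m + v y $ m) \<in> H2" "H2_norm (\<lambda>y. u0 y $ m + v y $ m) \<le> A"
    if "v \<in> H2v_ball \<rho>" for v m
    using in_ball(1,2)[OF that] H2_norm_component_le[of "\<lambda>x. u0 x + v x" m]
    by (auto simp: H2v_def)
  have G: "(\<lambda>y. g (u0 y + v y) $ m) \<in> L2" "L2_norm (\<lambda>y. g (u0 y + v y) $ m) \<le> M * A"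
    if v: "v \<in> H2v_ball \<rho>" for v m
  proof -
    \<comment> \<open>comparison with the zero function, using that \<open>g\<close> vanishes at zero\<close>
    have c: "(\<lambda>y. g (u0 y + v y) $ m - g 0 $ m) \<in> L2"
      "L2_norm (\<lambda>y. g (u0 y + v y) $ m - g 0 $ m) \<le> M * H2v_norm (\<lambda>y. u0 y + v y - 0)"
      using in_ball[OF v] S0 assms(4)
      by (intro comp[where u = "\<lambda>y. u0 y + v y" and w = "\<lambda>y. 0"]; simp add: S H2v_zero)+
    show "(\<lambda>y. g (u0 y + v y) $ m) \<in> L2" using c(1) assms(15) by simp
    have "M * H2v_norm (\<lambda>y. u0 y + v y) \<le> M * A" using in_ball(2)[OF v] assms(4) by simp
    with c(2) assms(15) show "L2_norm (\<lambda>y. g (u0 y + v y) $ m) \<le> M * A" by simp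
  qed
  have self: "?t v \<in> H2v_ball \<rho>" if v: "v \<in> H2v_ball \<rho>" for v
  proof -
    have b: "(\<lambda>x. ?t v x $ m) \<in> H2"
      "H2_norm (\<lambda>x. ?t v x $ m) \<le> c_a * (onorm_H2 (T m) * W21_norm (K m)) *
          (H2_norm (\<lambda>y. u0 y $ m + v y $ m) * L2_norm (\<lambda>y. g (u0 y + v y) $ m))" for m
      unfolding t_map_component
      by (rule H2_operator_mult_conv[OF alg less_imp_le[OF assms(7)] T K f(1)[OF v] G(1)[OF v]])+
    have "H2_norm (\<lambda>x. ?t v x $ m) \<le> (c_a * (A * (M * A))) * (onorm_H2 (T m) * W21_norm (K m))" for m
    proof -
      have "H2_norm (\<lambda>x. ?t v x $ m) \<le> c_a * (onorm_H2 (T m) * W21_norm (K m)) *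
          (H2_norm (\<lambda>y. u0 y $ m + v y $ m) * L2_norm (\<lambda>y. g (u0 y + v y) $ m))"
        by (rule b(2))
      also have "\<dots> \<le> c_a * (onorm_H2 (T m) * W21_norm (K m)) * (A * (M * A))"
        using assms(4,7) W0[of m] A by (intro mult_left_mono mult_mono f G v) auto
      finally show ?thesis by (simp add: mult_ac)
    qed
    then have "H2v_norm (?t v) \<le> L2_set (\<lambda>m. (c_a * (A * (M * A))) * (onorm_H2 (T m) * W21_norm (K m))) UNIV"
      unfolding H2v_norm_eq by (intro L2_set_mono) auto
    also have "\<dots> = c_a * (A * (M * A)) * Q"
      unfolding Q_def Q_const_eq using assms(4,7) A by (intro L2_set_right_distrib[symmetric]) auto
    also have "\<dots> = c_a * M * A\<^sup>2 * Q" by (simp add: power2_eq_square)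
    also have "\<dots> \<le> \<rho>" using assms(18) \<rho> unfolding A_def Q_def by linarith
    finally have "H2v_norm (?t v) \<le> \<rho>" .
    moreover have "?t v \<in> H2v" unfolding H2v_def using b(1) by blast
    ultimately show ?thesis by (simp add: H2v_ball_def)
  qed
  \<comment> \<open>The two terms of the product rule contribute equally, hence the factor two. The smallness
    hypothesis says exactly that \<open>q * A \<le> \<rho>\<close>.\<close>
  define q where "q = 2 * c_a * M * A * Q"
  have q0: "0 \<le> q" using assms(4,7) A Q0 by (simp add: q_def)
  have "q * A \<le> \<rho>" using assms(18) unfolding q_def A_def[symmetric] Q_def[symmetric]
    by (simp add: power2_eq_square mult_ac)
  with \<rho> A1 have "q * A < 1 * A" by linarith
  then have q1: "q < 1" using A by (simp add: mult_less_cancel_right)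
  have contr: "H2v_norm (\<lambda>x. ?t v x - ?t w x) \<le> q * H2v_norm (\<lambda>x. v x - w x)"
    if v: "v \<in> H2v_ball \<rho>" and w: "w \<in> H2v_ball \<rho>" for v w
  proof -
    let ?d = "H2v_norm (\<lambda>x. v x - w x)"
    have "H2_norm (\<lambda>x. (?t v x - ?t w x) $ m)
        \<le> (c_a * (2 * (M * A * ?d))) * (onorm_H2 (T m) * W21_norm (K m))" for m
    proof -
      have d1: "H2_norm (\<lambda>x. (u0 x $ m + v x $ m) - (u0 x $ m + w x $ m)) \<le> ?d"
        using H2_norm_component_le[of "\<lambda>x. v x - w x" m] by simp
      have d2: "L2_norm (\<lambda>x. g (u0 x + v x) $ m - g (u0 x + w x) $ m) \<le> M * ?d"
      proof -
        have "L2_norm (\<lambda>x. g (u0 x + v x) $ m - g (u0 x + w x) $ m)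
            \<le> M * H2v_norm (\<lambda>x. (u0 x + v x) - (u0 x + w x))"
          using in_ball[OF v] in_ball[OF w] assms(4)
          by (intro comp(2)[where u = "\<lambda>y. u0 y + v y" and w = "\<lambda>y. u0 y + w y"]) (simp_all add: S)
        then show ?thesis by simp
      qed
      have "H2_norm (\<lambda>x. (?t v x - ?t w x) $ m) \<le> c_a * (onorm_H2 (T m) * W21_norm (K m)) *
          (H2_norm (\<lambda>x. (u0 x $ m + v x $ m) - (u0 x $ m + w x $ m)) * L2_norm (\<lambda>y. g (u0 y + v y) $ m)
          + H2_norm (\<lambda>y. u0 y $ m + w y $ m) * L2_norm (\<lambda>x. g (u0 x + v x) $ m - g (u0 x + w x) $ m))"
        unfolding vector_minus_component t_map_component
        by (rule H2_operator_mult_conv_diff[OF alg less_imp_le[OF assms(7)] T K f(1)[OF v] f(1)[OF w]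
              G(1)[OF v] G(1)[OF w]])
      also have "\<dots> \<le> c_a * (onorm_H2 (T m) * W21_norm (K m)) * (?d * (M * A) + A * (M * ?d))"
        using assms(4,7) W0[of m] A
        by (intro mult_left_mono add_mono mult_mono d1 d2 f G v w) auto
      finally show ?thesis by (simp add: mult_ac)
    qed
    then have "H2v_norm (\<lambda>x. ?t v x - ?t w x)
        \<le> L2_set (\<lambda>m. (c_a * (2 * (M * A * ?d))) * (onorm_H2 (T m) * W21_norm (K m))) UNIV"
      unfolding H2v_norm_eq[of "\<lambda>x. ?t v x - ?t w x"] by (intro L2_set_mono) auto
    also have "\<dots> = c_a * (2 * (M * A * ?d)) * Q"
      unfolding Q_def Q_const_eq using assms(4,7) A by (intro L2_set_right_distrib[symmetric]) auto
    also have "\<dots> = q * ?d" by (simp add: q_def)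
    finally show ?thesis .
  qed
  obtain u_p where u_p: "u_p \<in> H2v_ball \<rho>"
    "\<And>w. w \<in> H2v_ball \<rho> \<Longrightarrow> (AE x in lebesgue. ?t w x = w x) \<longleftrightarrow> (AE x in lebesgue. w x = u_p x)"
    by (rule H2v_ball_fixed_point[where t = ?t, OF less_imp_le[OF \<rho>(1)] q0 q1])
      (use self contr in auto)
  have sys: "(\<forall>m. AE x in lebesgue. w x $ m = T m (\<lambda>y. u0 y $ m + w y $ m) x
        * (\<integral>y. K m (x - y) * g (u0 y + w y) $ m \<partial>lebesgue))
      \<longleftrightarrow> (AE x in lebesgue. ?t w x = w x)" for w
  proof -
    have "(AE x in lebesgue. ?t w x = w x) \<longleftrightarrow> (AE x in lebesgue. \<forall>m\<in>UNIV. w x $ m = ?t w x $ m)"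
      by (auto simp: vec_eq_iff eq_commute)
    also have "\<dots> \<longleftrightarrow> (\<forall>m\<in>UNIV. AE x in lebesgue. w x $ m = ?t w x $ m)"
      by (rule AE_finite_all) simp
    finally show ?thesis by (simp add: t_map_def)
  qed
  have 1: "AE x in lebesgue. ?t u_p x = u_p x" using u_p by simp
  show ?thesis
    unfolding sys using self q0 q1 contr u_p 1 by blast
qed

end
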